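(* Let $\mathcal H_S=\mathbb C^2$ (a qubit) with orthonormal (pointer) basis $|0\rangle,|1\rangle$, let $N\ge 1$, and let $\mathcal H_{not},\mathcal H_1,\dots,\mathcal H_N$ be nonzero complex Hilbert spaces, with no restriction on their dimensions. Let $\varepsilon_0,\varepsilon_1\in\mathbb R$ and, for $i\in\{0,1\}$, let $\hat V^i_{not}$ and $\hat V^i_k$ ($1\le k\le N$) be self-adjoint operators on $\mathcal H_{not}$ and $\mathcal H_k$ respectively (no commutation between operators with different $i$ is assumed). Consider on $\mathcal H_S\otimes\mathcal H_{not}\otimes\bigotimes_k\mathcal H_k$ the pure dephasing Hamiltonian $$\hat H=\sum_{i\in\{0,1\}}\Big(\varepsilon_i|i\rangle\langle i|+|i\rangle\langle i|\otimes\hat V^i_{not}+\sum_{k=1}^N|i\rangle\langle i|\otimes\hat V^i_k\Big)$$ (identity operators on the remaining factors are understood), which generates the evolution operator $$\hat U(t)=\sum_i e^{-i\varepsilon_it}|i\rangle\langle i|\otimes e^{-i\hat V^i_{not}t}\otimes\bigotimes_k e^{-i\hat V^i_kt},$$ and the initial state $$\hat{\tilde\sigma}(0)=|\psi_0\rangle\langle\psi_0|\otimes\hat R_{not}(0)\otimes\bigotimes_{k=1}^N\hat\rho^k(0),\qquad |\psi_0\rangle=a_0|0\rangle+a_1|1\rangle,$$ where $|a_0|^2+|a_1|^2=1$, $a_0\neq0$, $a_1\ne 0$, and $\hat R_{not}(0)$, $\hat\rho^k(0)$ are arbitrary density operators. Let $\hat{\tilde\sigma}(t)=\hat U(t)\,\hat{\tilde\sigma}(0)\,\hat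 U(t)^\dagger$ and let $\hat\sigma(t)=\mathrm{Tr}_{\mathcal H_{not}}\hat{\tilde\sigma}(t)$ be the state of the qubit and the observed environments. If the evolution does not generate qubit-environment entanglement, then spectrum broadcast structure (SBS) states are not formed. That is, if at time $t$ the state $\hat{\tilde\sigma}(t)$ is separable with respect to the bipartition $\mathcal H_S\,|\,\mathcal H_{not}\otimes\bigotimes_k\mathcal H_k$, then $\hat\sigma(t)$ is not an SBS state with respect to the pointer basis $\{|0\rangle,|1\rangle\}$.
   Context: Units with $\hbar=1$. The space $\mathcal H_{not}$ describes the unobserved environment (which is traced out), and $\mathcal H_1,\dots,\mathcal H_N$ describe the observed environments. In the operators $\hat V^i$ the free Hamiltonian of the respective environment is included. A density operator on a bipartite space $\mathcal A\otimes\mathcal B$ is separable if it is a convex combination of product states $\alpha\otimes\beta$ (in infinite dimension: a trace-norm limit of such convex combinations); otherwise it is entangled. A density operator $\hat\sigma$ on $\mathcal H_S\otimes\bigotimes_{k=1}^N\mathcal H_k$ is a spectrum broadcast structure (SBS) state with respect to the orthonormal basis $\{|i\rangle\}$ of $\mathcal H_S$ if there are probabilities $p_i$ and density operators $\hat\rho^k_i$ on $\mathcal H_k$ with $$\hat\sigma=\sum_i p_i|i\rangle\langle i|\otimes\hat\rho^1_i\otimes\cdots\otimes\hat\rho^N_i,$$ such that for every $k$ and all $i\neq i'$ the operators $\hat\rho^k_i$ and $\hat\rho^k_{i'}$ have orthogonal supports, i.e. $\hat\rho^k_i\hat\rho^k_{i'}=0$. *)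

theory Defs
  imports "HOL-Analysis.Analysis"
begin

section \<open>Complex Hilbert spaces\<close>

class chilbert_space = real_inner + complete_space +
  fixes scaleC :: "complex \<Rightarrow> 'a \<Rightarrow> 'a"  (infixr "*\<^sub>C" 75)
    and cinner :: "'a \<Rightarrow> 'a \<Rightarrow> complex"
  assumes scaleR_scaleC: "r *\<^sub>R x = complex_of_real r *\<^sub>C x"
    and scaleC_add_right: "c *\<^sub>C (x + y) = c *\<^sub>C x + c *\<^sub>C y"
    and scaleC_add_left: "(c + d) *\<^sub>C x = c *\<^sub>C x + d *\<^sub>C x"
    and scaleC_scaleC: "c *\<^sub>C d *\<^sub>C x = (c * d) *\<^sub>C x"
    and cinner_commute: "cinner x y = cnj (cinner y x)"
    and cinner_add_right: "cinner x (y + z) = cinner x y + cinner x z"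
    and cinner_scaleC_right: "cinner x (c *\<^sub>C y) = c * cinner x y"
    and inner_cinner: "inner x y = Re (cinner x y)"

instantiation complex :: chilbert_space
begin

definition scaleC_complex :: "complex \<Rightarrow> complex \<Rightarrow> complex"
  where "scaleC_complex c x = c * x"

definition cinner_complex :: "complex \<Rightarrow> complex \<Rightarrow> complex"
  where "cinner_complex x y = cnj x * y"

instance
  by standard
    (auto simp: scaleC_complex_def cinner_complex_def scaleR_conv_of_real
      inner_complex_def algebra_simps)

end

instantiation vec :: (chilbert_space, finite) chilbert_space
begin

definition scaleC_vec :: "complex \<Rightarrow> 'a ^ 'b \<Rightarrow> 'a ^ 'b"
  where "scaleC_vec c x = (\<chi> i. c *\<^sub>C (x $ i))"

definition cinner_vec :: "'a ^ 'b \<Rightarrow> 'a ^ 'b \<Rightarrow> complex"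
  where "cinner_vec x y = (\<Sum>i\<in>UNIV. cinner (x $ i) (y $ i))"

instance
proof
  fix x y z :: "'a ^ 'b" and c d :: complex and r :: real
  show "r *\<^sub>R x = complex_of_real r *\<^sub>C x"
    by (simp add: scaleC_vec_def vec_eq_iff scaleR_scaleC)
  show "c *\<^sub>C (x + y) = c *\<^sub>C x + c *\<^sub>C y"
    by (simp add: scaleC_vec_def vec_eq_iff scaleC_add_right)
  show "(c + d) *\<^sub>C x = c *\<^sub>C x + d *\<^sub>C x"
    by (simp add: scaleC_vec_def vec_eq_iff scaleC_add_left)
  show "c *\<^sub>C d *\<^sub>C x = (c * d) *\<^sub>C x"
    by (simp add: scaleC_vec_def vec_eq_iff scaleC_scaleC)
  show "cinner x y = cnj (cinner y x)"
    unfolding cinner_vec_def cnj_sum by (rule sum.cong[OF refl], rule cinner_commute)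
  show "cinner x (y + z) = cinner x y + cinner x z"
    by (simp add: cinner_vec_def cinner_add_right sum.distrib)
  show "cinner x (c *\<^sub>C y) = c * cinner x y"
    by (simp add: cinner_vec_def scaleC_vec_def cinner_scaleC_right sum_distrib_left)
  show "inner x y = Re (cinner x y)"
    by (simp add: cinner_vec_def inner_vec_def inner_cinner)
qed

end

text \<open>
  A family of Hilbert spaces of different dimensions cannot be a family of types. Its members
  are therefore closed complex subspaces of one ambient space; this is no restriction, since
  every family embeds into its Hilbert direct sum. Notions carrying a set argument \<open>S\<close>
  speak about the Hilbert space \<open>S\<close>, and operators on \<open>S\<close> are functions whose
  values outside \<open>S\<close> are irrelevant.
\<close>

definition closed_csubspace :: "'a::chilbert_space set \<Rightarrow> bool"
  where "closed_csubspace S \<longleftrightarrow>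
    subspace S \<and> (\<forall>c. \<forall>x\<in>S. c *\<^sub>C x \<in> S) \<and> closed S"

definition onb_on :: "'a::chilbert_space set \<Rightarrow> 'a set \<Rightarrow> bool"
  where "onb_on S B \<longleftrightarrow>
    B \<subseteq> S \<and> (\<forall>e\<in>B. \<forall>f\<in>B. cinner e f = (if e = f then 1 else 0)) \<and>
    (\<forall>x\<in>S. (\<forall>e\<in>B. cinner e x = 0) \<longrightarrow> x = 0)"


section \<open>Bounded operators, traces and density operators\<close>

definition clinear_on :: "'a::chilbert_space set \<Rightarrow> ('a \<Rightarrow> 'b::chilbert_space) \<Rightarrow> bool"
  where "clinear_on S A \<longleftrightarrow>
    (\<forall>x\<in>S. \<forall>y\<in>S. A (x + y) = A x + A y) \<and> (\<forall>c. \<forall>x\<in>S. A (c *\<^sub>C x) = c *\<^sub>C A x)"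

definition bounded_op_on :: "'a::chilbert_space set \<Rightarrow> ('a \<Rightarrow> 'a) \<Rightarrow> bool"
  where "bounded_op_on S A \<longleftrightarrow>
    (\<forall>x\<in>S. A x \<in> S) \<and> clinear_on S A \<and> (\<exists>K. \<forall>x\<in>S. norm (A x) \<le> K * norm x)"

definition cadjoint :: "('a::chilbert_space \<Rightarrow> 'a) \<Rightarrow> 'a \<Rightarrow> 'a"
  where "cadjoint A = (SOME B. \<forall>x y. cinner (A x) y = cinner x (B y))"

definition positive_op_on :: "'a::chilbert_space set \<Rightarrow> ('a \<Rightarrow> 'a) \<Rightarrow> bool"
  where "positive_op_on S A \<longleftrightarrow>
    bounded_op_on S A \<and> (\<forall>x\<in>S. cinner x (A x) \<in> \<real>\<^sub>\<ge>\<^sub>0)"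

definition has_trace_on :: "'a::chilbert_space set \<Rightarrow> ('a \<Rightarrow> 'a) \<Rightarrow> complex \<Rightarrow> bool"
  where "has_trace_on S A c \<longleftrightarrow>
    (\<forall>B. onb_on S B \<longrightarrow> ((\<lambda>e. cinner e (A e)) has_sum c) B)"

definition density_on :: "'a::chilbert_space set \<Rightarrow> ('a \<Rightarrow> 'a) \<Rightarrow> bool"
  where "density_on S \<rho> \<longleftrightarrow> positive_op_on S \<rho> \<and> has_trace_on S \<rho> 1"

text \<open>
  The trace norm of \<open>A\<close> is the trace of \<open>P = |A|\<close>, the positive operator with
  \<open>P\<^sup>2 = A\<^sup>\<dagger> A\<close>; the equation is written in terms of matrix elements.
\<close>

definition has_trace_norm :: "('a::chilbert_space \<Rightarrow> 'a) \<Rightarrow> real \<Rightarrow> bool"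
  where "has_trace_norm A r \<longleftrightarrow>
    bounded_op_on UNIV A \<and>
    (\<exists>P. positive_op_on UNIV P \<and> (\<forall>x y. cinner (P x) (P y) = cinner (A x) (A y)) \<and>
      has_trace_on UNIV P (complex_of_real r))"

definition ketbra :: "'a::chilbert_space \<Rightarrow> 'a \<Rightarrow> 'a \<Rightarrow> 'a"
  where "ketbra \<psi> \<phi> x = cinner \<phi> x *\<^sub>C \<psi>"


section \<open>Self-adjoint operators and the evolution they generate\<close>

text \<open>
  Hamiltonians may be unbounded; they are represented by their graphs. A densely defined
  operator has a single-valued adjoint, and the adjoint of any graph is a closed linear
  subspace, so a relation satisfying \<open>self_adjoint_on\<close> is the graph of a linear operator.
\<close>

definition adjoint_graph :: "'a::chilbert_space set \<Rightarrow> ('a \<times> 'a) set \<Rightarrow> ('a \<times> 'a) set"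
  where "adjoint_graph S V =
    {(y, z). y \<in> S \<and> z \<in> S \<and> (\<forall>(x, w)\<in>V. cinner w y = cinner x z)}"

definition self_adjoint_on :: "'a::chilbert_space set \<Rightarrow> ('a \<times> 'a) set \<Rightarrow> bool"
  where "self_adjoint_on S V \<longleftrightarrow>
    V \<subseteq> S \<times> S \<and> S \<subseteq> closure (Domain V) \<and> V = adjoint_graph S V"

definition unitary_group_on :: "'a::chilbert_space set \<Rightarrow> (real \<Rightarrow> 'a \<Rightarrow> 'a) \<Rightarrow> bool"
  where "unitary_group_on S U \<longleftrightarrow>
    (\<forall>t. \<forall>x\<in>S. U t x \<in> S) \<and> (\<forall>t. clinear_on S (U t)) \<and>
    (\<forall>t. \<forall>x\<in>S. \<forall>y\<in>S. cinner (U t x) (U t y) = cinner x y) \<and>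
    (\<forall>x\<in>S. U 0 x = x) \<and> (\<forall>s t. \<forall>x\<in>S. U (s + t) x = U s (U t x)) \<and>
    (\<forall>x\<in>S. continuous_on UNIV (\<lambda>t. U t x))"

text \<open>
  \<open>evolution_on S V U\<close> says \<open>U t = exp (-\<i> V t)\<close>: \<open>U\<close> is the strongly continuous
  unitary group whose infinitesimal generator is \<open>-\<i> V\<close>, domain included. By Stone's theorem
  there is exactly one such group for every self-adjoint \<open>V\<close>.
\<close>

definition evolution_on ::
    "'a::chilbert_space set \<Rightarrow> ('a \<times> 'a) set \<Rightarrow> (real \<Rightarrow> 'a \<Rightarrow> 'a) \<Rightarrow> bool"
  where "evolution_on S V U \<longleftrightarrow>
    unitary_group_on S U \<and>
    V = {(x, y). x \<in> S \<and> y \<in> S \<and>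
          ((\<lambda>t. U t x) has_vector_derivative (- \<i>) *\<^sub>C y) (at 0)}"


section \<open>Tensor products\<close>

text \<open>
  A Hilbert tensor product is given by its product map: a multilinear map that multiplies inner
  products and whose values span a dense subspace. This determines it up to a unique
  unitary, so statements are made for every such realisation. Complex multiples of
  product vectors are product vectors, hence the real span is the complex one (for the
  family version this needs a nonempty index set).
\<close>

definition hilbert_tensor ::
    "('a::chilbert_space \<Rightarrow> 'b::chilbert_space \<Rightarrow> 'c::chilbert_space) \<Rightarrow> bool"
  where "hilbert_tensor T \<longleftrightarrow>
    (\<forall>x. clinear_on UNIV (T x)) \<and> (\<forall>y. clinear_on UNIV (\<lambda>x. T x y)) \<and>
    (\<forall>x y x' y'. cinner (T x y) (T x' y') = cinner x x' * cinner y y') \<and>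
    closure (span {T x y | x y. True}) = UNIV"

definition hilbert_tensor_family ::
    "'k set \<Rightarrow> ('k \<Rightarrow> 'a::chilbert_space set) \<Rightarrow> (('k \<Rightarrow> 'a) \<Rightarrow> 'c::chilbert_space) \<Rightarrow> bool"
  where "hilbert_tensor_family I H T \<longleftrightarrow>
    (\<forall>x\<in>Pi I H. \<forall>k\<in>I. clinear_on (H k) (\<lambda>y. T (x(k := y)))) \<and>
    (\<forall>x\<in>Pi I H. \<forall>y\<in>Pi I H. cinner (T x) (T y) = (\<Prod>k\<in>I. cinner (x k) (y k))) \<and>
    closure (span (T ` Pi I H)) = UNIV"

definition tensor_op ::
    "('a::chilbert_space \<Rightarrow> 'b::chilbert_space \<Rightarrow> 'c::chilbert_space) \<Rightarrow>
      ('a \<Rightarrow> 'a) \<Rightarrow> ('b \<Rightarrow> 'b) \<Rightarrow> ('c \<Rightarrow> 'c) \<Rightarrow> bool"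
  where "tensor_op T A B C \<longleftrightarrow>
    bounded_op_on UNIV C \<and> (\<forall>x y. C (T x y) = T (A x) (B y))"

definition tensor_op_family ::
    "'k set \<Rightarrow> ('k \<Rightarrow> 'a::chilbert_space set) \<Rightarrow> (('k \<Rightarrow> 'a) \<Rightarrow> 'c::chilbert_space) \<Rightarrow>
      ('k \<Rightarrow> 'a \<Rightarrow> 'a) \<Rightarrow> ('c \<Rightarrow> 'c) \<Rightarrow> bool"
  where "tensor_op_family I H T A C \<longleftrightarrow>
    bounded_op_on UNIV C \<and> (\<forall>x\<in>Pi I H. C (T x) = T (\<lambda>k. A k (x k)))"

text \<open>
  With \<open>TSE\<close>, \<open>TRO\<close>, \<open>TSO\<close> the product maps of \<open>S \<otimes> (R \<otimes> O)\<close>,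
  \<open>R \<otimes> O\<close> and \<open>S \<otimes> O\<close>, the operator \<open>B\<close> on \<open>S \<otimes> O\<close> is the partial
  trace over \<open>R\<close> of the operator \<open>A\<close>.
\<close>

definition is_partial_trace ::
    "('s::chilbert_space \<Rightarrow> 'e::chilbert_space \<Rightarrow> 't::chilbert_space) \<Rightarrow>
      ('r::chilbert_space \<Rightarrow> 'o::chilbert_space \<Rightarrow> 'e) \<Rightarrow>
      ('s \<Rightarrow> 'o \<Rightarrow> 'q::chilbert_space) \<Rightarrow> ('t \<Rightarrow> 't) \<Rightarrow> ('q \<Rightarrow> 'q) \<Rightarrow> bool"
  where "is_partial_trace TSE TRO TSO A B \<longleftrightarrow>
    bounded_op_on UNIV B \<and>
    (\<forall>F. onb_on UNIV F \<longrightarrow>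
      (\<forall>s s' w w'. ((\<lambda>e. cinner (TSE s (TRO e w)) (A (TSE s' (TRO e w')))) has_sum
         cinner (TSO s w) (B (TSO s' w'))) F))"


section \<open>Separable states\<close>

definition product_state ::
    "('a::chilbert_space \<Rightarrow> 'b::chilbert_space \<Rightarrow> 'c::chilbert_space) \<Rightarrow> ('c \<Rightarrow> 'c) \<Rightarrow> bool"
  where "product_state T C \<longleftrightarrow>
    (\<exists>\<alpha> \<beta>. density_on UNIV \<alpha> \<and> density_on UNIV \<beta> \<and> tensor_op T \<alpha> \<beta> C)"

definition product_state_mixture ::
    "('a::chilbert_space \<Rightarrow> 'b::chilbert_space \<Rightarrow> 'c::chilbert_space) \<Rightarrow> ('c \<Rightarrow> 'c) \<Rightarrow> bool"
  where "product_state_mixture T \<tau> \<longleftrightarrow>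
    (\<exists>(n::nat) p C. (\<forall>j<n. 0 \<le> p j \<and> product_state T (C j)) \<and> (\<Sum>j<n. p j) = 1 \<and>
      \<tau> = (\<lambda>x. \<Sum>j<n. p j *\<^sub>R C j x))"

text \<open>
  In finite dimension the mixtures already form a closed set, so the limit adds nothing there.
\<close>

definition separable_state ::
    "('a::chilbert_space \<Rightarrow> 'b::chilbert_space \<Rightarrow> 'c::chilbert_space) \<Rightarrow> ('c \<Rightarrow> 'c) \<Rightarrow> bool"
  where "separable_state T \<sigma> \<longleftrightarrow>
    (\<exists>\<tau> r. (\<forall>n::nat. product_state_mixture T (\<tau> n) \<and>
               has_trace_norm (\<lambda>x. \<sigma> x - \<tau> n x) (r n)) \<and>
      r \<longlonglongrightarrow> 0)"


section \<open>Spectrum broadcast structure\<close>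

definition sbs_state ::
    "'i set \<Rightarrow> ('i \<Rightarrow> 's::chilbert_space) \<Rightarrow> 'k set \<Rightarrow> ('k \<Rightarrow> 'h::chilbert_space set) \<Rightarrow>
      (('k \<Rightarrow> 'h) \<Rightarrow> 'o::chilbert_space) \<Rightarrow> ('s \<Rightarrow> 'o \<Rightarrow> 'q::chilbert_space) \<Rightarrow>
      ('q \<Rightarrow> 'q) \<Rightarrow> bool"
  where "sbs_state J ket I H TO TSO \<sigma> \<longleftrightarrow>
    (\<exists>p \<rho> \<rho>O C.
      (\<forall>i\<in>J. 0 \<le> p i) \<and> (\<Sum>i\<in>J. p i) = 1 \<and>
      (\<forall>i\<in>J. \<forall>k\<in>I. density_on (H k) (\<rho> i k)) \<and>
      (\<forall>i\<in>J. tensor_op_family I H TO (\<rho> i) (\<rho>O i)) \<and>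
      (\<forall>i\<in>J. tensor_op TSO (ketbra (ket i) (ket i)) (\<rho>O i) (C i)) \<and>
      \<sigma> = (\<lambda>x. \<Sum>i\<in>J. p i *\<^sub>R C i x) \<and>
      (\<forall>k\<in>I. \<forall>i\<in>J. \<forall>i'\<in>J. i \<noteq> i' \<longrightarrow> (\<forall>x\<in>H k. \<rho> i k (\<rho> i' k x) = 0)))"


section \<open>Pure dephasing Hamiltonian\<close>

text \<open>
  The sum of the terms is formed on the span of the vectors
  \<open>|i\<rangle> \<otimes> r \<otimes> \<Otimes>\<^sub>k x k\<close> with \<open>r\<close> in the domain of \<open>Vnot i\<close> and \<open>x k\<close> in the domain of \<open>V i k\<close>;
  it is essentially self-adjoint there, and the Hamiltonian is its closure. In the graph
  below \<open>r'\<close> and \<open>y k\<close> are the images of \<open>r\<close> and \<open>x k\<close>. The spanning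
  set is stable under complex scaling because the graphs of the \<open>Vnot i\<close> are.
\<close>

definition dephasing_hamiltonian ::
    "'i set \<Rightarrow> ('i \<Rightarrow> 's::chilbert_space) \<Rightarrow> 'k set \<Rightarrow>
      (('k \<Rightarrow> 'h::chilbert_space) \<Rightarrow> 'o::chilbert_space) \<Rightarrow>
      ('r::chilbert_space \<Rightarrow> 'o \<Rightarrow> 'e::chilbert_space) \<Rightarrow>
      ('s \<Rightarrow> 'e \<Rightarrow> 't::chilbert_space) \<Rightarrow>
      ('i \<Rightarrow> real) \<Rightarrow> ('i \<Rightarrow> ('r \<times> 'r) set) \<Rightarrow> ('i \<Rightarrow> 'k \<Rightarrow> ('h \<times> 'h) set) \<Rightarrow> ('t \<times> 't) set"
  where "dephasing_hamiltonian J ket I TO TRO TSE \<epsilon> Vnot V =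
    closure (span
      {(TSE (ket i) (TRO r (TO x)),
        \<epsilon> i *\<^sub>R TSE (ket i) (TRO r (TO x)) + TSE (ket i) (TRO r' (TO x)) +
        (\<Sum>k\<in>I. TSE (ket i) (TRO r (TO (x(k := y k)))))) | i r r' x y.
       i \<in> J \<and> (r, r') \<in> Vnot i \<and> (\<forall>k\<in>I. (x k, y k) \<in> V i k)})"

end

theory Submission
  imports Defs
begin

text \<open>
  Separability makes the partial transpose of the total state positive. For pure dephasing this
  bounds \<open>\<langle>V e, \<rho> V e\<rangle>\<^sup>2\<close> by \<open>\<langle>e, \<rho> e\<rangle> \<langle>V\<^sup>2 e, \<rho> V\<^sup>2 e\<rangle>\<close>, where
  \<open>\<rho>\<close> is the initial state of the whole environment and \<open>V\<close> compares its two conditional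
  evolutions. So \<open>\<langle>V\<^sup>n e, \<rho> V\<^sup>n e\<rangle>\<close> is a bounded log-convex function of the integer \<open>n\<close>, hence
  constant: both pointer states leave the environment in the same conditional state. This
  persists after tracing out the unobserved environment, while in a spectrum broadcast structure
  the two conditional states would have to be orthogonal, hence zero.

  The product form of the evolution follows from the uniqueness of solutions of Schroedinger's
  equation on product vectors of domain elements, which span a dense subspace.
\<close>


section \<open>Inner products and positive operators\<close>

text \<open>The two conditional evolutions need not commute, so nothing diagonalises both of them;
  their comparison map is only iterated, and all its iterates meet the same norm bound of \<rho>.
  Separability enters through two inequalities between matrix elements in product vectors: they hold
  factorwise for product states and survive convex combinations and trace-norm limits. The
  conditional evolutions of the whole environment are not built as tensor products of operators: the
  total evolution maps each subspace of vectors |i> \<otimes> e into itself, and they are read off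
  from this. Both amplitudes are nonzero, so their squared moduli cancel from the inequality for the
  off-diagonal block. The equality of the conditional states is kept at the level of matrix elements
  because the partial trace is a sum of these. One probability of the broadcast structure may
  vanish, so the final contradiction starts from the conditional state whose weight is
  nonzero.\<close>

lemma cinner_add_left: "cinner (x + y) z = cinner x z + cinner y z"
  for x y z :: "'a::chilbert_space"
  by (metis cinner_commute cinner_add_right complex_cnj_add)

lemma cinner_scaleC_left: "cinner (c *\<^sub>C x) y = cnj c * cinner x y"
  for x y :: "'a::chilbert_space"
  by (metis cinner_commute cinner_scaleC_right complex_cnj_mult)

lemma scaleC_one [simp]: "1 *\<^sub>C x = x" for x :: "'a::chilbert_space"
  using scaleR_scaleC[of 1 x] by simp

lemma scaleC_zero_left [simp]: "0 *\<^sub>C x = 0" for x :: "'a::chilbert_space"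
  using scaleR_scaleC[of 0 x] by simp

lemma scaleC_zero_right [simp]: "c *\<^sub>C 0 = (0::'a::chilbert_space)"
  using scaleC_add_right[of c "0::'a" 0] by simp

lemma scaleC_minus_one: "(- 1) *\<^sub>C x = - x" for x :: "'a::chilbert_space"
  using scaleR_scaleC[of "-1" x] by simp

lemma scaleC_sum_right: "c *\<^sub>C (\<Sum>i\<in>A. f i) = (\<Sum>i\<in>A. c *\<^sub>C f i)"
  for f :: "'i \<Rightarrow> 'a::chilbert_space"
  by (induction A rule: infinite_finite_induct) (auto simp: scaleC_add_right)

lemma cinner_zero_right [simp]: "cinner x 0 = 0" for x :: "'a::chilbert_space"
  using cinner_add_right[of x 0 0] by simp

lemma cinner_zero_left [simp]: "cinner 0 x = 0" for x :: "'a::chilbert_space"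
  using cinner_add_left[of 0 0 x] by simp

lemma cinner_minus_right: "cinner x (- y) = - cinner x y" for x y :: "'a::chilbert_space"
  using cinner_add_right[of x y "- y"] by (simp add: add_eq_0_iff)

lemma cinner_minus_left: "cinner (- x) y = - cinner x y" for x y :: "'a::chilbert_space"
  using cinner_add_left[of x "- x" y] by (simp add: add_eq_0_iff)

lemma cinner_diff_right: "cinner x (y - z) = cinner x y - cinner x z"
  for x y z :: "'a::chilbert_space"
  using cinner_add_right[of x y "- z"] by (simp add: cinner_minus_right)

lemma cinner_diff_left: "cinner (x - y) z = cinner x z - cinner y z"
  for x y z :: "'a::chilbert_space"
  using cinner_add_left[of x "- y" z] by (simp add: cinner_minus_left)

lemma cinner_sum_right: "cinner x (\<Sum>i\<in>A. f i) = (\<Sum>i\<in>A. cinner x (f i))"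
  for f :: "'i \<Rightarrow> 'a::chilbert_space"
  by (induction A rule: infinite_finite_induct) (auto simp: cinner_add_right)

lemma cinner_scaleR_right: "cinner x (r *\<^sub>R y) = of_real r * cinner x y"
  for x y :: "'a::chilbert_space"
  by (simp add: scaleR_scaleC cinner_scaleC_right)

lemma cinner_self: "cinner x x = of_real ((norm x)\<^sup>2)" for x :: "'a::chilbert_space"
proof -
  have "Im (cinner x x) = 0"
    using cinner_commute[of x x] by (simp add: complex_eq_iff)
  then show ?thesis
    by (simp add: complex_eq_iff flip: inner_cinner power2_norm_eq_inner)
qed

lemma cinner_eqI: "x = y" if "\<And>z. cinner z x = cinner z y" for x y :: "'a::chilbert_space"
proof -
  have "cinner (x - y) (x - y) = 0"
    using that by (simp add: cinner_diff_right)
  then show ?thesis by (simp add: cinner_self)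
qed

lemma norm_scaleC: "norm (c *\<^sub>C x) = cmod c * norm x" for x :: "'a::chilbert_space"
proof -
  have "complex_of_real ((norm (c *\<^sub>C x))\<^sup>2) = complex_of_real ((cmod c * norm x)\<^sup>2)"
    unfolding cinner_self[symmetric] cinner_scaleC_left cinner_scaleC_right
    by (simp add: cinner_self power_mult_distrib complex_norm_square mult_ac flip: of_real_power)
  then show ?thesis
    unfolding of_real_eq_iff by (rule power2_eq_imp_eq) auto
qed

lemma bounded_opD:
  assumes "bounded_op_on UNIV A"
  shows "A (x + y) = A x + A y" "A (c *\<^sub>C x) = c *\<^sub>C A x" "A (x - y) = A x - A y"
    "A 0 = 0"
proof -
  show add: "A (x + y) = A x + A y" for x y
    using assms by (simp add: bounded_op_on_def clinear_on_def)
  show scale: "A (c *\<^sub>C x) = c *\<^sub>C A x" for c x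
    using assms by (simp add: bounded_op_on_def clinear_on_def)
  show "A (x - y) = A x - A y"
    using add[of x "(- 1) *\<^sub>C y"] unfolding scale by (simp add: scaleC_minus_one)
  show "A 0 = 0"
    using scale[of 0 0] by simp
qed

text \<open>Polarization with \<open>x + y\<close> and \<open>x + \<i> *\<^sub>C y\<close>: over the
  complex numbers the diagonal determines a sesquilinear form. The set \<open>S\<close> is kept
  because operators on a subspace are unconstrained outside it.\<close>

lemma sesquilinear_eq_0:
  fixes B :: "'a::chilbert_space \<Rightarrow> 'a \<Rightarrow> complex"
  assumes S: "\<And>x y. x \<in> S \<Longrightarrow> y \<in> S \<Longrightarrow> x + y \<in> S" "\<And>c x. x \<in> S \<Longrightarrow> c *\<^sub>C x \<in> S"
    and add: "\<And>x y z. \<lbrakk>x \<in> S; y \<in> S; z \<in> S\<rbrakk> \<Longrightarrow> B (x + y) z = B x z + B y z"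
      "\<And>x y z. \<lbrakk>x \<in> S; y \<in> S; z \<in> S\<rbrakk> \<Longrightarrow> B x (y + z) = B x y + B x z"
    and scale: "\<And>c x y. \<lbrakk>x \<in> S; y \<in> S\<rbrakk> \<Longrightarrow> B (c *\<^sub>C x) y = cnj c * B x y"
      "\<And>c x y. \<lbrakk>x \<in> S; y \<in> S\<rbrakk> \<Longrightarrow> B x (c *\<^sub>C y) = c * B x y"
    and zero: "\<And>x. x \<in> S \<Longrightarrow> B x x = 0"
    and xy: "x \<in> S" "y \<in> S"
  shows "B x y = 0"
proof -
  have 1: "B x y + B y x = 0"
    using zero[of "x + y"] zero[of x] zero[of y] xy by (simp add: S add add_ac)
  have "B (x + \<i> *\<^sub>C y) (x + \<i> *\<^sub>C y) = 0"
    using xy by (intro zero S)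
  then have "\<i> * B x y - \<i> * B y x = 0"
    using xy zero[of x] zero[of y] by (simp add: S add scale)
  then have "\<i> * (B x y - B y x) = 0"
    by (simp only: right_diff_distrib)
  then have "B x y = B y x" by (metis mult_eq_0_iff complex_i_not_zero right_minus_eq)
  with 1 show ?thesis by (metis mult_2 mult_eq_0_iff zero_neq_numeral)
qed

text \<open>Real expectation values make the form \<open>cinner x (A y) - cinner (A x) y\<close>
  vanish on the diagonal, and polarization does the rest.\<close>

lemma positive_op_hermitian:
  assumes S: "closed_csubspace S" and A: "positive_op_on S A" and xy: "x \<in> S" "y \<in> S"
  shows "cinner x (A y) = cinner (A x) y"
proof -
  have AS: "A z \<in> S" if "z \<in> S" for z
    using A that by (simp add: positive_op_on_def bounded_op_on_def)
  have lin: "clinear_on S A"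
    using A by (simp add: positive_op_on_def bounded_op_on_def)
  have real: "cinner z (A z) \<in> \<real>" if "z \<in> S" for z
    using A that nonneg_Reals_subset_Reals by (auto simp: positive_op_on_def)
  have "cinner x (A y) - cinner (A x) y = 0"
  proof (rule sesquilinear_eq_0[where S = S and B = "\<lambda>x y. cinner x (A y) - cinner (A x) y"])
    show "x + y \<in> S" if "x \<in> S" "y \<in> S" for x y
      using S that by (simp add: closed_csubspace_def subspace_add)
    show "c *\<^sub>C x \<in> S" if "x \<in> S" for c x
      using S that by (simp add: closed_csubspace_def)
    show "cinner x (A x) - cinner (A x) x = 0" if "x \<in> S" for x
      using real[OF that] cinner_commute[of "A x" x] by (simp add: Reals_cnj_iff)
  qed (use lin xy in \<open>auto simp: clinear_on_def cinner_add_left cinner_add_right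
        cinner_scaleC_left cinner_scaleC_right algebra_simps\<close>)
  then show ?thesis by simp
qed

lemma closed_csubspace_UNIV [simp]: "closed_csubspace UNIV"
  by (simp add: closed_csubspace_def)

lemma positive_op_cinner_self:
  assumes "positive_op_on S A" "x \<in> S"
  shows "cinner x (A x) = of_real (Re (cinner x (A x)))" "Re (cinner x (A x)) \<ge> 0"
  using assms by (auto simp: positive_op_on_def complex_nonneg_Reals_iff complex_eq_iff)

lemma positive_op_Cauchy_Schwarz:
  assumes A: "positive_op_on UNIV A"
  shows "(cmod (cinner x (A y)))\<^sup>2 \<le> Re (cinner x (A x)) * Re (cinner y (A y))"
proof -
  define z where "z = cinner x (A y)"
  have bo: "bounded_op_on UNIV A" using A by (simp add: positive_op_on_def)
  have yx: "cinner y (A x) = cnj z"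
    unfolding z_def using positive_op_hermitian[OF _ A, of y x] cinner_commute by simp
  have *: "0 \<le> Re (cinner x (A x)) - 2 * s * (cmod z)\<^sup>2 + s\<^sup>2 * (cmod z)\<^sup>2 * Re (cinner y (A y))" for s
  proof -
    \<comment> \<open>The factor \<open>cnj z\<close> gives both cross terms the same real value,
      leaving a real quadratic in \<open>s\<close>.\<close>
    define c where "c = - of_real s * cnj z"
    have "cinner (x + c *\<^sub>C y) (A (x + c *\<^sub>C y)) =
        cinner x (A x) + c * z + cnj c * cnj z + cnj c * c * cinner y (A y)"
      unfolding bounded_opD[OF bo] cinner_add_left cinner_add_right
        cinner_scaleC_left cinner_scaleC_right yx z_def
      by (simp add: algebra_simps)
    also have "c * z = - of_real (s * (cmod z)\<^sup>2)"
      by (simp add: c_def complex_norm_square mult.commute del: of_real_power)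
    also have "cnj c * cnj z = - of_real (s * (cmod z)\<^sup>2)"
      by (simp add: c_def complex_norm_square del: of_real_power)
    also have "cnj c * c = of_real (s\<^sup>2 * (cmod z)\<^sup>2)"
      using complex_norm_square[of z] by (simp add: c_def power2_eq_square mult_ac)
    finally have "Re (cinner (x + c *\<^sub>C y) (A (x + c *\<^sub>C y))) =
        Re (cinner x (A x)) - 2 * s * (cmod z)\<^sup>2 + s\<^sup>2 * (cmod z)\<^sup>2 * Re (cinner y (A y))"
      by simp
    then show ?thesis using positive_op_cinner_self(2)[OF A, of "x + c *\<^sub>C y"] by simp
  qed
  show ?thesis
  proof (cases "Re (cinner y (A y)) = 0")
    case True
    have "z = 0"
    proof (rule ccontr)
      assume "z \<noteq> 0"
      \<comment> \<open>The quadratic term is absent, and this \<open>s\<close> turns the right-hand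
        side into -1.\<close>
      with *[of "(Re (cinner x (A x)) + 1) / (2 * (cmod z)\<^sup>2)"] True show False
        by simp
    qed
    then show ?thesis
      using True by (simp add: z_def)
  next
    case False
    then have pos: "Re (cinner y (A y)) > 0"
      using positive_op_cinner_self(2)[OF A, of y] by simp
    \<comment> \<open>The quadratic is evaluated at its minimiser
      \<open>s = 1 / Re (cinner y (A y))\<close>.\<close>
    then have "0 \<le> Re (cinner x (A x)) - (cmod z)\<^sup>2 / Re (cinner y (A y))"
      using *[of "1 / Re (cinner y (A y))"] by (simp add: field_simps power2_eq_square)
    then show ?thesis
      using pos by (simp add: z_def field_simps)
  qed
qed

lemma cinner_Cauchy_Schwarz: "cmod (cinner x y) \<le> norm x * norm y"
  for x y :: "'a::chilbert_space"
proof -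
  have "positive_op_on UNIV (\<lambda>x::'a. x)"
    by (auto simp: positive_op_on_def bounded_op_on_def clinear_on_def cinner_self
        intro!: exI[of _ 1])
  from positive_op_Cauchy_Schwarz[OF this, of x y]
  have "(cmod (cinner x y))\<^sup>2 \<le> (norm x * norm y)\<^sup>2"
    by (simp add: cinner_self power_mult_distrib)
  then show ?thesis
    by (rule power2_le_imp_le) simp
qed

lemma bounded_bilinear_cinner: "bounded_bilinear (cinner :: 'a::chilbert_space \<Rightarrow> 'a \<Rightarrow> complex)"
  by (rule bounded_bilinear.intro)
    (auto simp: cinner_add_left cinner_add_right cinner_scaleC_left cinner_scaleC_right
      scaleR_scaleC scaleC_complex_def intro!: exI[of _ 1] cinner_Cauchy_Schwarz)

lemma bounded_bilinear_scaleC: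
  "bounded_bilinear (scaleC :: complex \<Rightarrow> 'a::chilbert_space \<Rightarrow> 'a)"
proof
  fix r :: real and c :: complex and x :: 'a
  show "(r *\<^sub>R c) *\<^sub>C x = r *\<^sub>R c *\<^sub>C x"
    by (simp add: scaleR_scaleC[of r] scaleC_scaleC scaleC_complex_def)
  show "c *\<^sub>C r *\<^sub>R x = r *\<^sub>R c *\<^sub>C x"
    by (simp add: scaleR_scaleC scaleC_scaleC mult.commute)
qed (auto simp: scaleC_add_left scaleC_add_right norm_scaleC intro!: exI[of _ 1])

lemmas tendsto_cinner = bounded_bilinear.tendsto[OF bounded_bilinear_cinner]
lemmas tendsto_scaleC = bounded_bilinear.tendsto[OF bounded_bilinear_scaleC]


section \<open>Orthonormal bases and the trace norm\<close>

text \<open>\<open>onb_on\<close> expresses completeness by the absence of a nonzero orthogonal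
  vector, so a maximal orthonormal set qualifies: such a vector, normalised, would enlarge it.
  Starting from a given \<open>B0\<close> allows a prescribed unit vector to be a basis
  element.\<close>

lemma onb_on_extend:
  assumes S: "closed_csubspace S" and B0: "B0 \<subseteq> S"
    "\<And>e f. e \<in> B0 \<Longrightarrow> f \<in> B0 \<Longrightarrow> cinner e f = (if e = f then 1 else 0)"
  obtains B where "B0 \<subseteq> B" "onb_on S B"
proof -
  define \<A> where "\<A> = {B. B0 \<subseteq> B \<and> B \<subseteq> S \<and>
    (\<forall>e\<in>B. \<forall>f\<in>B. cinner e f = (if e = f then 1 else 0))}"
  have "B0 \<in> \<A>" using B0 by (auto simp: \<A>_def)
  have "\<exists>M\<in>\<A>. \<forall>X\<in>\<A>. M \<subseteq> X \<longrightarrow> X = M"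
  proof (rule subset_Zorn_nonempty)
    show "\<A> \<noteq> {}" using \<open>B0 \<in> \<A>\<close> by blast
    show "\<Union>\<C> \<in> \<A>" if "\<C> \<noteq> {}" and ch: "subset.chain \<A> \<C>" for \<C>
    proof -
      have sub: "\<C> \<subseteq> \<A>" using ch by (simp add: subset.chain_def)
      have "cinner e f = (if e = f then 1 else 0)" if "e \<in> \<Union>\<C>" "f \<in> \<Union>\<C>" for e f
      proof -
        obtain X Y where XY: "X \<in> \<C>" "e \<in> X" "Y \<in> \<C>" "f \<in> Y" using \<open>e \<in> \<Union>\<C>\<close> \<open>f \<in> \<Union>\<C>\<close> by blast
        have "X \<subseteq> Y \<or> Y \<subseteq> X"
          using ch XY unfolding subset.chain_def by blast
        then obtain Z where "Z \<in> \<C>" "e \<in> Z" "f \<in> Z" using XY by blast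
        then show ?thesis using sub by (auto simp: \<A>_def)
      qed
      then show ?thesis
        using sub \<open>\<C> \<noteq> {}\<close> unfolding \<A>_def by blast
    qed
  qed
  then obtain M where M: "M \<in> \<A>" and max: "\<And>X. X \<in> \<A> \<Longrightarrow> M \<subseteq> X \<Longrightarrow> X = M" by blast
  have "x = 0" if "x \<in> S" and orth: "\<forall>e\<in>M. cinner e x = 0" for x
  proof (rule ccontr)
    assume "x \<noteq> 0"
    define y where "y = (1 / norm x) *\<^sub>R x"
    have y1: "cinner y y = 1"
      using \<open>x \<noteq> 0\<close> by (simp add: cinner_self y_def)
    have y0: "cinner e y = 0" "cinner y e = 0" if "e \<in> M" for e
      using orth that cinner_commute[of y e] by (auto simp: y_def cinner_scaleR_right)
    have "y \<in> S"
      using S \<open>x \<in> S\<close> by (simp add: y_def closed_csubspace_def subspace_scale)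
    have "y \<notin> M" using y0 y1 by fastforce
    have "insert y M \<in> \<A>"
      using M \<open>y \<in> S\<close> \<open>y \<notin> M\<close> y0 y1 unfolding \<A>_def by auto
    with max \<open>y \<notin> M\<close> show False by blast
  qed
  with M show ?thesis
    by (intro that[of M]) (auto simp: \<A>_def onb_on_def)
qed

lemma onb_on_exists:
  assumes "closed_csubspace S"
  obtains B where "onb_on S B"
  using onb_on_extend[OF assms, of "{}"] by blast

lemma onb_pair_expansion:
  assumes "inj_on ket {i, j}" "onb_on UNIV (ket ` {i, j})" "i \<noteq> j"
  shows "cinner (ket i) (ket i) = 1" "cinner (ket j) (ket j) = 1"
    "cinner (ket i) (ket j) = 0" "cinner (ket j) (ket i) = 0"
    "s = cinner (ket i) s *\<^sub>C ket i + cinner (ket j) s *\<^sub>C ket j"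
proof -
  have "ket i \<noteq> ket j" using assms by (auto dest: inj_onD)
  then show *: "cinner (ket i) (ket i) = 1" "cinner (ket j) (ket j) = 1"
    "cinner (ket i) (ket j) = 0" "cinner (ket j) (ket i) = 0"
    using assms(2) by (auto simp: onb_on_def)
  have onb: "\<forall>x. (\<forall>e\<in>ket ` {i, j}. cinner e x = 0) \<longrightarrow> x = 0"
    using assms(2) by (simp add: onb_on_def)
  have "s - (cinner (ket i) s *\<^sub>C ket i + cinner (ket j) s *\<^sub>C ket j) = 0"
    by (rule onb[rule_format]) (auto simp: cinner_diff_right cinner_add_right cinner_scaleC_right *)
  then show "s = cinner (ket i) s *\<^sub>C ket i + cinner (ket j) s *\<^sub>C ket j" by simp
qed

text \<open>The trace condition quantifies over bases, so it has content only once a basis exists;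
  then the diagonal elements sum to 1 and cannot all vanish.\<close>

lemma density_nonzero:
  assumes S: "closed_csubspace S" and \<rho>: "density_on S \<rho>"
  obtains x where "x \<in> S" "\<rho> x \<noteq> 0"
proof -
  obtain B where B: "onb_on S B" using onb_on_exists[OF S] .
  have "((\<lambda>e. cinner e (\<rho> e)) has_sum 1) B"
    using \<rho> B by (simp add: density_on_def has_trace_on_def)
  then have "\<exists>e\<in>B. cinner e (\<rho> e) \<noteq> 0"
    by (metis has_sum_0 has_sum_unique zero_neq_one)
  then show ?thesis
    using B that by (force simp: onb_on_def)
qed

text \<open>By hermiticity \<open>cinner x (\<rho> (\<rho> x))\<close> is the squared norm of
  \<open>\<rho> x\<close>. The square matters because orthogonality of supports is stated through
  products of two density operators.\<close>

lemma density_sq_nonzero: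
  assumes S: "closed_csubspace S" and \<rho>: "density_on S \<rho>"
  obtains x where "x \<in> S" "\<rho> (\<rho> x) \<noteq> 0"
proof -
  obtain x where x: "x \<in> S" "\<rho> x \<noteq> 0" using density_nonzero[OF S \<rho>] .
  have pos: "positive_op_on S \<rho>" using \<rho> by (simp add: density_on_def)
  then have "\<rho> x \<in> S" using x by (simp add: positive_op_on_def bounded_op_on_def)
  then have "cinner x (\<rho> (\<rho> x)) = cinner (\<rho> x) (\<rho> x)"
    using positive_op_hermitian[OF S pos] x by blast
  then have "\<rho> (\<rho> x) \<noteq> 0" using x by (auto simp: cinner_self)
  then show ?thesis using x that by blast
qed

text \<open>The trace of \<open>P = |A|\<close> bounds its expectation in every unit vector, and
  Cauchy-Schwarz for the form of \<open>P\<close> lifts this to \<open>norm (P x)\<close>, which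
  equals \<open>norm (A x)\<close>. Convergence in trace norm thereby reaches individual matrix
  elements.\<close>

lemma norm_le_has_trace_norm:
  assumes "has_trace_norm A r"
  shows "norm (A x) \<le> r * norm x"
proof -
  obtain P where P: "positive_op_on UNIV P" and PA: "\<And>x y. cinner (P x) (P y) = cinner (A x) (A y)"
    and tr: "has_trace_on UNIV P (of_real r)"
    using assms by (auto simp: has_trace_norm_def)
  have bo: "bounded_op_on UNIV P" using P by (simp add: positive_op_on_def)
  have le: "Re (cinner y (P y)) \<le> r" if y: "norm y = 1" for y
  proof -
    \<comment> \<open>Completed to a basis, the unit vector contributes its expectation as one of
      the nonnegative terms of the trace.\<close>
    obtain B where B: "{y} \<subseteq> B" "onb_on UNIV B"
      by (rule onb_on_extend[of UNIV "{y}"]) (auto simp: cinner_self y)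
    have "((\<lambda>e. cinner e (P e)) has_sum of_real r) B"
      using tr B by (simp add: has_trace_on_def)
    from has_sum_Re[OF this] have hs: "((\<lambda>e. Re (cinner e (P e))) has_sum r) B" by simp
    have "((\<lambda>e. Re (cinner e (P e))) has_sum Re (cinner y (P y))) {y}"
      using has_sum_finite[of "{y}" "\<lambda>e. Re (cinner e (P e))"] by simp
    from has_sum_mono2[OF this hs B(1)] show ?thesis
      using positive_op_cinner_self(2)[OF P] by simp
  qed
  have le': "Re (cinner y (P y)) \<le> r * (norm y)\<^sup>2" for y
  proof (cases "y = 0")
    case False
    have "P (of_real (1 / norm y) *\<^sub>C y) = of_real (1 / norm y) *\<^sub>C P y"
      by (rule bounded_opD(2)[OF bo])
    then have "Re (cinner ((1 / norm y) *\<^sub>R y) (P ((1 / norm y) *\<^sub>R y))) = Re (cinner y (P y)) / (norm y)\<^sup>2"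
      by (simp add: scaleR_scaleC cinner_scaleC_left cinner_scaleC_right power2_eq_square del: of_real_divide)
    with le[of "(1 / norm y) *\<^sub>R y"] False show ?thesis
      by (simp add: field_simps)
  qed (simp add: bounded_opD[OF bo])
  \<comment> \<open>The left-hand side is the fourth power of \<open>norm (P x)\<close>; bounding
    both factors on the right by \<open>le'\<close> leaves a common square of that norm to
    cancel.\<close>
  have "(cmod (cinner (P x) (P x)))\<^sup>2 \<le> Re (cinner (P x) (P (P x))) * Re (cinner x (P x))"
    by (rule positive_op_Cauchy_Schwarz[OF P])
  also have "\<dots> \<le> (r * (norm (P x))\<^sup>2) * (r * (norm x)\<^sup>2)"
    using le' positive_op_cinner_self(2)[OF P] by (intro mult_mono) (auto intro: order_trans)
  finally have *: "(norm (P x))\<^sup>2 * (norm (P x))\<^sup>2 \<le> (norm (P x))\<^sup>2 * (r * norm x)\<^sup>2"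
    by (simp add: cinner_self norm_power norm_mult power2_eq_square algebra_simps)
  have r0: "0 \<le> r * norm x"
  proof (cases "x = 0")
    case False
    have "0 \<le> r * (norm x)\<^sup>2" using le'[of x] positive_op_cinner_self(2)[OF P UNIV_I, of x] by linarith
    with False show ?thesis by (simp add: zero_le_mult_iff)
  qed simp
  have "(norm (P x))\<^sup>2 \<le> (r * norm x)\<^sup>2"
  proof (cases "P x = 0")
    case False
    then show ?thesis using mult_left_le_imp_le[OF *] by simp
  qed simp
  then have "norm (P x) \<le> r * norm x"
    by (rule power2_le_imp_le[OF _ r0])
  moreover have "norm (P x) = norm (A x)"
    using PA[of x x] by (simp add: cinner_self flip: of_real_power)
  ultimately show ?thesis by simp
qed

section \<open>Tensor products\<close>

lemma hilbert_tensorD: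
  assumes "hilbert_tensor T"
  shows "T (x + x') y = T x y + T x' y" "T x (y + y') = T x y + T x y'"
    "T (c *\<^sub>C x) y = c *\<^sub>C T x y" "T x (c *\<^sub>C y) = c *\<^sub>C T x y"
    "cinner (T x y) (T x' y') = cinner x x' * cinner y y'"
    "closure (span {T x y | x y. True}) = UNIV"
  using assms by (simp_all add: hilbert_tensor_def clinear_on_def)

lemma hilbert_tensor_norm: "norm (T x y) = norm x * norm y" if "hilbert_tensor T"
proof -
  have "complex_of_real ((norm (T x y))\<^sup>2) = complex_of_real ((norm x * norm y)\<^sup>2)"
    unfolding cinner_self[symmetric] hilbert_tensorD(5)[OF that]
    by (simp add: cinner_self power_mult_distrib)
  then show ?thesis
    unfolding of_real_eq_iff by (rule power2_eq_imp_eq) auto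
qed

lemma hilbert_tensor_bounded_bilinear: "bounded_bilinear T" if "hilbert_tensor T"
  by (rule bounded_bilinear.intro)
    (auto simp: hilbert_tensorD[OF that] scaleR_scaleC hilbert_tensor_norm[OF that]
      intro!: exI[of _ 1])

text \<open>In the expansion of the squared norm of \<open>f t - l\<close> the remaining cross term
  is the conjugate of the given one, so two limits suffice.\<close>

lemma tendsto_of_cinner:
  fixes f :: "'x \<Rightarrow> 'd::chilbert_space"
  assumes "((\<lambda>t. cinner (f t) (f t)) \<longlongrightarrow> cinner l l) F" "((\<lambda>t. cinner (f t) l) \<longlongrightarrow> cinner l l) F"
  shows "(f \<longlongrightarrow> l) F"
proof -
  have "((\<lambda>t. cinner (f t) (f t) - cinner (f t) l - cnj (cinner (f t) l) + cinner l l) \<longlongrightarrow>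
      cinner l l - cinner l l - cnj (cinner l l) + cinner l l) F"
    by (intro tendsto_intros assms)
  moreover have "cinner (f t) (f t) - cinner (f t) l - cnj (cinner (f t) l) + cinner l l =
      of_real ((norm (f t - l))\<^sup>2)" for t
    unfolding cinner_self[symmetric] cinner_diff_left cinner_diff_right cinner_commute[of l "f t"]
    by simp
  ultimately have "((\<lambda>t. complex_of_real ((norm (f t - l))\<^sup>2)) \<longlongrightarrow> 0) F"
    using cinner_commute[of l l] by simp
  from tendsto_Re[OF this] have "((\<lambda>t. (norm (f t - l))\<^sup>2) \<longlongrightarrow> 0) F" by simp
  from tendsto_real_sqrt[OF this] have "((\<lambda>t. norm (f t - l)) \<longlongrightarrow> 0) F" by simp
  then show ?thesis
    by (rule LIM_zero_cancel[OF tendsto_norm_zero_cancel])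
qed

section \<open>Tensor products of families of subspaces\<close>

context
  fixes I :: "'k set" and H :: "'k \<Rightarrow> 'a::chilbert_space set"
    and T :: "('k \<Rightarrow> 'a) \<Rightarrow> 'c::chilbert_space"
  assumes T: "hilbert_tensor_family I H T"
begin

lemma tensor_family_cinner:
  "x \<in> Pi I H \<Longrightarrow> y \<in> Pi I H \<Longrightarrow> cinner (T x) (T y) = (\<Prod>k\<in>I. cinner (x k) (y k))"
  using T by (simp add: hilbert_tensor_family_def)

lemma tensor_family_add:
  assumes "x \<in> Pi I H" "k \<in> I" "y \<in> H k" "z \<in> H k"
  shows "T (x(k := y + z)) = T (x(k := y)) + T (x(k := z))"
  using T assms by (auto simp: hilbert_tensor_family_def clinear_on_def)

lemma tensor_family_scaleC:
  assumes "x \<in> Pi I H" "k \<in> I" "y \<in> H k"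
  shows "T (x(k := c *\<^sub>C y)) = c *\<^sub>C T (x(k := y))"
  using T assms by (auto simp: hilbert_tensor_family_def clinear_on_def)

lemma tensor_family_dense: "closure (span (T ` Pi I H)) = UNIV"
  using T by (simp add: hilbert_tensor_family_def)

text \<open>
  By the product formula for inner products, convergence of the factors already forces
  convergence of the inner products; multilinearity is not involved.
\<close>

lemma tensor_family_tendsto:
  assumes c: "\<And>t. c t \<in> Pi I H" and x: "x \<in> Pi I H"
    and lim: "\<And>k. k \<in> I \<Longrightarrow> ((\<lambda>t. c t k) \<longlongrightarrow> x k) F"
  shows "((\<lambda>t. T (c t)) \<longlongrightarrow> T x) F"
proof (rule tendsto_of_cinner)
  show "((\<lambda>t. cinner (T (c t)) (T (c t))) \<longlongrightarrow> cinner (T x) (T x)) F"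
    "((\<lambda>t. cinner (T (c t)) (T x)) \<longlongrightarrow> cinner (T x) (T x)) F"
    unfolding tensor_family_cinner[OF c c] tensor_family_cinner[OF c x] tensor_family_cinner[OF x x]
    by (intro tendsto_prod tendsto_cinner lim tendsto_const | assumption)+
qed

text \<open>Arguments of \<open>T\<close> are total functions, but inner products see only the
  coordinates in \<open>I\<close>. The convergence lemma, applied to a constant sequence, turns this
  into equality of the product vectors.\<close>

lemma tensor_family_cong:
  assumes "x \<in> Pi I H" "\<And>k. k \<in> I \<Longrightarrow> y k = x k"
  shows "T y = T x"
proof -
  have y: "y \<in> Pi I H" using assms by auto
  have "((\<lambda>t::nat. T y) \<longlongrightarrow> T x) sequentially"
    by (rule tensor_family_tendsto) (use assms y in auto)
  then show ?thesis using LIMSEQ_const_iff by blast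
qed

lemma tensor_family_norm:
  assumes "x \<in> Pi I H"
  shows "norm (T x) = (\<Prod>k\<in>I. norm (x k))"
proof -
  have "complex_of_real ((norm (T x))\<^sup>2) = complex_of_real ((\<Prod>k\<in>I. norm (x k))\<^sup>2)"
    unfolding cinner_self[symmetric] tensor_family_cinner[OF assms assms]
    by (simp add: cinner_self prod_power_distrib)
  then show ?thesis
    unfolding of_real_eq_iff by (rule power2_eq_imp_eq) (auto intro: prod_nonneg)
qed

end

section \<open>Derivatives of product vectors\<close>

lemma has_vector_derivative_at_0_iff:
  fixes f :: "real \<Rightarrow> 'a::real_normed_vector"
  shows "(f has_vector_derivative D) (at 0) \<longleftrightarrow> ((\<lambda>h. (f h - f 0) /\<^sub>R h) \<longlongrightarrow> D) (at 0)"
proof -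
  have "norm (f h - f 0 - h *\<^sub>R D) / norm h = norm ((f h - f 0) /\<^sub>R h - D)" if "h \<noteq> 0" for h
  proof -
    have "(f h - f 0) /\<^sub>R h - D = (f h - f 0 - h *\<^sub>R D) /\<^sub>R h"
      using that by (simp add: scaleR_diff_right)
    then show ?thesis by (simp add: divide_inverse)
  qed
  then have "((\<lambda>h. norm (f h - f 0 - h *\<^sub>R D) / norm h) \<longlongrightarrow> 0) (at 0) \<longleftrightarrow>
      ((\<lambda>h. norm ((f h - f 0) /\<^sub>R h - D)) \<longlongrightarrow> 0) (at 0)"
    by (intro tendsto_cong) (auto simp: eventually_at_filter)
  then show ?thesis
    by (simp add: has_vector_derivative_def has_derivative_iff_norm bounded_linear_scaleR_left
        tendsto_norm_zero_iff LIM_zero_iff)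
qed

text \<open>Product rule by telescoping: in \<open>d J\<close> the slots in \<open>J\<close> follow
  the curve and the others are frozen at time 0. Adding an index to \<open>J\<close> changes one
  slot, where linearity turns the difference of product vectors into a difference quotient.\<close>

lemma tensor_family_has_vector_derivative:
  assumes T: "hilbert_tensor_family I H T" and I: "finite I"
    and H: "\<And>k. k \<in> I \<Longrightarrow> closed_csubspace (H k)"
    and c: "\<And>t. c t \<in> Pi I H" and y: "y \<in> Pi I H"
    and der: "\<And>k. k \<in> I \<Longrightarrow> ((\<lambda>t. c t k) has_vector_derivative y k) (at 0)"
  shows "((\<lambda>t. T (c t)) has_vector_derivative (\<Sum>k\<in>I. T ((c 0)(k := y k)))) (at 0)"
proof -
  define d where "d J t k = (if k \<in> J then c t k else c 0 k)" for J t k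
  have d: "d J t \<in> Pi I H" for J t
    using c[of t] c[of 0] by (auto simp: d_def Pi_iff)
  have d0: "d J 0 = c 0" for J
    by (auto simp: d_def)
  have lim: "((\<lambda>t. d J t k) \<longlongrightarrow> c 0 k) (at 0)" if "k \<in> I" for J k
  proof -
    have "((\<lambda>t. c t k) \<longlongrightarrow> c 0 k) (at 0)"
      using has_vector_derivative_continuous[OF der[OF that]] by (simp add: continuous_within)
    then show ?thesis by (cases "k \<in> J") (simp_all add: d_def)
  qed
  have der_J: "((\<lambda>t. T (d J t)) has_vector_derivative (\<Sum>k\<in>J. T ((c 0)(k := y k)))) (at 0)"
    if "finite J" "J \<subseteq> I" for J
    using that
  proof (induction J rule: finite_induct)
    case empty
    then show ?case by (simp add: d_def)
  next
    case (insert j J)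
    then have j: "j \<in> I" by simp
    have cj: "c t j \<in> H j" for t by (rule Pi_mem[OF c j])
    have sub: "(c t j - c 0 j) /\<^sub>R t \<in> H j" "c t j - c 0 j \<in> H j" for t
      using H[OF j] cj[of t] cj[of 0] by (simp_all add: closed_csubspace_def subspace_scale subspace_diff)
    have eq: "(T (d (insert j J) t) - T (d J t)) /\<^sub>R t =
        T ((d J t)(j := (c t j - c 0 j) /\<^sub>R t))" for t
    proof -
      have "d (insert j J) t = (d J t)(j := c 0 j + (c t j - c 0 j))"
        by (auto simp: d_def)
      then have "T (d (insert j J) t) = T ((d J t)(j := c 0 j)) + T ((d J t)(j := c t j - c 0 j))"
        using tensor_family_add[OF T d j cj sub(2)] by metis
      moreover have "(d J t)(j := c 0 j) = d J t"
        using insert.hyps by (auto simp: d_def)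
      ultimately show ?thesis
        by (simp add: scaleR_scaleC tensor_family_scaleC[OF T d j sub(2)])
    qed
    \<comment> \<open>A joint limit: slot \<open>j\<close> carries the quotient while the slots in
      \<open>J\<close> are still moving.\<close>
    have "((\<lambda>t. T ((d J t)(j := (c t j - c 0 j) /\<^sub>R t))) \<longlongrightarrow> T ((c 0)(j := y j))) (at 0)"
    proof (rule tensor_family_tendsto[OF T])
      show "(d J t)(j := (c t j - c 0 j) /\<^sub>R t) \<in> Pi I H" for t
        using d[of J t] sub[of t] by (auto simp: Pi_iff)
      show "(c 0)(j := y j) \<in> Pi I H"
        using c[of 0] y by (auto simp: Pi_iff)
      show "((\<lambda>t. ((d J t)(j := (c t j - c 0 j) /\<^sub>R t)) k) \<longlongrightarrow> ((c 0)(j := y j)) k) (at 0)"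
        if "k \<in> I" for k
        using lim[OF that] der[OF j, unfolded has_vector_derivative_at_0_iff] by auto
    qed
    then have "((\<lambda>t. T (d (insert j J) t) - T (d J t)) has_vector_derivative T ((c 0)(j := y j))) (at 0)"
      unfolding has_vector_derivative_at_0_iff eq[symmetric] by (simp add: d0)
    from has_vector_derivative_add[OF this insert.IH] insert.prems
    have "((\<lambda>t. T (d (insert j J) t)) has_vector_derivative
        T ((c 0)(j := y j)) + (\<Sum>k\<in>J. T ((c 0)(k := y k)))) (at 0)"
      by (simp del: fun_upd_apply)
    then show ?case
      unfolding sum.insert[OF insert.hyps] .
  qed
  have "T (d I t) = T (c t)" for t
    by (rule tensor_family_cong[OF T c]) (simp add: d_def)
  then show ?thesis
    using der_J[OF I subset_refl] by (simp only:)
qed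


section \<open>Unitary groups\<close>

lemma clinear_onD:
  assumes "closed_csubspace S" "clinear_on S A" "x \<in> S" "y \<in> S"
  shows "A (x + y) = A x + A y" "A (c *\<^sub>C x) = c *\<^sub>C A x" "A (r *\<^sub>R x) = r *\<^sub>R A x"
    "A (x - y) = A x - A y"
proof -
  have S: "c *\<^sub>C z \<in> S" if "z \<in> S" for c z
    using assms(1) that by (simp add: closed_csubspace_def)
  have scale: "A (c *\<^sub>C z) = c *\<^sub>C A z" if "z \<in> S" for c z
    using assms(2) that by (simp add: clinear_on_def)
  have add: "A (z + w) = A z + A w" if "z \<in> S" "w \<in> S" for z w
    using assms(2) that by (simp add: clinear_on_def)
  show "A (x + y) = A x + A y" "A (c *\<^sub>C x) = c *\<^sub>C A x" "A (r *\<^sub>R x) = r *\<^sub>R A x"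
    using add scale assms(3,4) by (simp_all add: scaleR_scaleC)
  show "A (x - y) = A x - A y"
    using add[of x "- y"] scale[of y "-1"] S[of y "-1"] assms(3,4) by (simp add: scaleC_minus_one)
qed

context
  fixes S :: "'a::chilbert_space set" and U :: "real \<Rightarrow> 'a \<Rightarrow> 'a"
  assumes S: "closed_csubspace S" and U: "unitary_group_on S U"
begin

lemma unitary_group_mem: "x \<in> S \<Longrightarrow> U t x \<in> S"
  using U by (simp add: unitary_group_on_def)

lemma unitary_group_linear:
  assumes "x \<in> S" "y \<in> S"
  shows "U t (x + y) = U t x + U t y" "U t (c *\<^sub>C x) = c *\<^sub>C U t x" "U t (r *\<^sub>R x) = r *\<^sub>R U t x"
    "U t (x - y) = U t x - U t y"
proof -
  have "clinear_on S (U t)"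
    using U by (simp add: unitary_group_on_def)
  note linear = clinear_onD[OF S this assms]
  show "U t (x + y) = U t x + U t y" "U t (c *\<^sub>C x) = c *\<^sub>C U t x" "U t (r *\<^sub>R x) = r *\<^sub>R U t x"
    "U t (x - y) = U t x - U t y"
    by (fact linear)+
qed

lemma unitary_group_cinner: "x \<in> S \<Longrightarrow> y \<in> S \<Longrightarrow> cinner (U t x) (U t y) = cinner x y"
  using U by (simp add: unitary_group_on_def)

lemma unitary_group_norm: "x \<in> S \<Longrightarrow> norm (U t x) = norm x"
  using unitary_group_cinner[of x x t] by (simp add: cinner_self flip: of_real_power)

lemma unitary_group_0: "x \<in> S \<Longrightarrow> U 0 x = x"
  using U by (simp add: unitary_group_on_def)

lemma unitary_group_add: "x \<in> S \<Longrightarrow> U (s + t) x = U s (U t x)"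
  using U by (simp add: unitary_group_on_def)

lemma unitary_group_inverse:
  assumes "x \<in> S"
  shows "U t (U (- t) x) = x" "U (- t) (U t x) = x"
  using unitary_group_add[OF assms, of t "- t"] unitary_group_add[OF assms, of "- t" t]
    unitary_group_0[OF assms] by simp_all

lemma unitary_group_tendsto:
  assumes f: "\<And>a. f a \<in> S" and l: "l \<in> S" and lim: "(f \<longlongrightarrow> l) F"
  shows "((\<lambda>a. U t (f a)) \<longlongrightarrow> U t l) F"
proof -
  have "norm (U t (f a) - U t l) = norm (f a - l)" for a
    using unitary_group_linear(4)[OF f l] unitary_group_norm[of "f a - l"] S f l
    by (simp add: closed_csubspace_def subspace_diff)
  moreover have "((\<lambda>a. norm (f a - l)) \<longlongrightarrow> 0) F"
    using lim by (simp add: tendsto_norm_zero_iff LIM_zero_iff)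
  ultimately have "((\<lambda>a. norm (U t (f a) - U t l)) \<longlongrightarrow> 0) F" by simp
  then show ?thesis by (simp add: tendsto_norm_zero_iff LIM_zero_iff)
qed

end

text \<open>\<open>U s\<close> commutes with \<open>U h\<close> and is isometric, so it carries the
  convergent difference quotient at \<open>x\<close> to the one at \<open>U s x\<close>. Domain
  vectors therefore remain in the domain along the evolution.\<close>

lemma evolution_on_graph_invariant:
  assumes S: "closed_csubspace S" and ev: "evolution_on S V U" and xy: "(x, y) \<in> V"
  shows "(U s x, U s y) \<in> V"
proof -
  have U: "unitary_group_on S U" and V: "V = {(x, y). x \<in> S \<and> y \<in> S \<and>
      ((\<lambda>t. U t x) has_vector_derivative (- \<i>) *\<^sub>C y) (at 0)}"
    using ev by (auto simp: evolution_on_def)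
  have x: "x \<in> S" and y: "y \<in> S"
    and der: "((\<lambda>t. U t x) has_vector_derivative (- \<i>) *\<^sub>C y) (at 0)"
    using xy V by auto
  note [simp] = unitary_group_mem[OF S U]
  have Sc: "c *\<^sub>C z \<in> S" "r *\<^sub>R z \<in> S" "z - w \<in> S" if "z \<in> S" "w \<in> S" for c r z w
    using S that by (auto simp: closed_csubspace_def subspace_scale subspace_diff)
  have "((\<lambda>h. U s ((U h x - U 0 x) /\<^sub>R h)) \<longlongrightarrow> U s ((- \<i>) *\<^sub>C y)) (at 0)"
    using der x y unfolding has_vector_derivative_at_0_iff
    by (intro unitary_group_tendsto[OF S U] Sc) auto
  moreover have "U s ((U h x - U 0 x) /\<^sub>R h) = (U h (U s x) - U 0 (U s x)) /\<^sub>R h" for h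
    using x by (simp add: unitary_group_linear[OF S U] Sc unitary_group_add[OF S U, symmetric] add.commute)
  moreover have "U s ((- \<i>) *\<^sub>C y) = (- \<i>) *\<^sub>C U s y"
    using y by (simp add: unitary_group_linear[OF S U])
  ultimately show ?thesis
    using x y unfolding V by (simp add: has_vector_derivative_at_0_iff)
qed

text \<open>
  The curve \<open>s \<mapsto> U (- s) (\<phi> s)\<close> moves from \<open>s\<close> to \<open>s + h\<close> by
  \<open>norm (\<phi> (s + h) - U h (\<phi> s))\<close>, which is of order \<open>o(h)\<close>, so it is constant.
\<close>

lemma unitary_group_unique:
  assumes U: "unitary_group_on UNIV U"
    and \<phi>: "\<And>s. ((\<lambda>h. \<phi> (s + h)) has_vector_derivative D s) (at 0)"
    and U': "\<And>s. ((\<lambda>h. U h (\<phi> s)) has_vector_derivative D s) (at 0)"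
  shows "\<phi> t = U t (\<phi> 0)"
proof -
  have \<phi>0: "U 0 (\<phi> s) = \<phi> s" for s
    by (simp add: unitary_group_0[OF _ U])
  define f where "f s = U (- s) (\<phi> s)" for s
  have "(f has_vector_derivative 0) (at s)" for s
  proof -
    have "((\<lambda>h. \<phi> (s + h) - U h (\<phi> s)) has_vector_derivative D s - D s) (at 0)"
      by (intro has_vector_derivative_diff \<phi> U')
    then have "((\<lambda>h. (\<phi> (s + h) - U h (\<phi> s)) /\<^sub>R h) \<longlongrightarrow> 0) (at 0)"
      using \<phi>0[of s] by (simp add: has_vector_derivative_at_0_iff)
    then have "((\<lambda>h. norm ((\<phi> (s + h) - U h (\<phi> s)) /\<^sub>R h)) \<longlongrightarrow> 0) (at 0)"
      by (rule tendsto_norm_zero)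
    moreover have "norm ((\<phi> (s + h) - U h (\<phi> s)) /\<^sub>R h) = norm ((f (s + h) - f (s + 0)) /\<^sub>R h)" for h
    proof -
      have "U (- (s + h)) (\<phi> (s + h) - U h (\<phi> s)) = f (s + h) - U (- (s + h)) (U h (\<phi> s))"
        by (simp add: f_def unitary_group_linear[OF _ U])
      also have "U (- (s + h)) (U h (\<phi> s)) = f s"
        using unitary_group_add[OF _ U, of "\<phi> s" "- (s + h)" h] by (simp add: f_def)
      finally show ?thesis
        using unitary_group_norm[OF _ U, of "\<phi> (s + h) - U h (\<phi> s)" "- (s + h)"] by simp
    qed
    ultimately have "((\<lambda>h. norm ((f (s + h) - f (s + 0)) /\<^sub>R h)) \<longlongrightarrow> 0) (at 0)"
      by (simp only:)
    then have "((\<lambda>h. f (s + h)) has_vector_derivative 0) (at 0)"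
      unfolding has_vector_derivative_at_0_iff by (rule tendsto_norm_zero_cancel)
    moreover have "((\<lambda>x. x - s) has_vector_derivative 1) (at s)"
      by (auto intro!: derivative_eq_intros)
    ultimately show ?thesis
      using vector_diff_chain_at[of "\<lambda>x. x - s" 1 s "\<lambda>h. f (s + h)" 0] by (simp add: o_def)
  qed
  then obtain c where "\<And>s. f s = c"
    using has_vector_derivative_zero_constant[of UNIV f] by auto
  then have "U t (f t) = U t (\<phi> 0)"
    using \<phi>0[of 0] by (metis f_def minus_zero)
  then show ?thesis by (simp add: f_def unitary_group_inverse[OF _ U])
qed

text \<open>\<open>cadjoint\<close> is a choice, so besides the adjoint equation for
  \<open>U (- t)\<close> its uniqueness is required; nondegeneracy of the inner product provides
  it.\<close>

lemma cadjoint_unitary_group: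
  assumes UG: "unitary_group_on UNIV U"
  shows "cadjoint (U t) = U (- t)"
  unfolding cadjoint_def
proof (rule some_equality)
  show adj: "\<forall>x y. cinner (U t x) y = cinner x (U (- t) y)"
  proof (intro allI)
    show "cinner (U t x) y = cinner x (U (- t) y)" for x y
      using unitary_group_cinner[OF _ UG, of x "U (- t) y" t] unitary_group_inverse(1)[OF _ UG, of y t]
      by simp
  qed
  show "B = U (- t)" if "\<forall>x y. cinner (U t x) y = cinner x (B y)" for B
    by (rule ext, rule cinner_eqI) (metis that adj)
qed

lemma unitary_group_bounded_linear:
  assumes "unitary_group_on UNIV U"
  shows "bounded_linear (U t)"
  by (rule bounded_linear_intro[where K = 1])
    (auto simp: unitary_group_linear[OF _ assms] unitary_group_norm[OF _ assms])


section \<open>The evolution of product vectors\<close>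

text \<open>Product rule for phase, unobserved factor and observed factors; the three contributions
  are the three kinds of terms of the Hamiltonian.\<close>

lemma has_vector_derivative_product_curve:
  assumes TO: "hilbert_tensor_family I H TO" and I: "finite I"
    and H: "\<And>k. k \<in> I \<Longrightarrow> closed_csubspace (H k)"
    and TRO: "hilbert_tensor TRO" and TSE: "hilbert_tensor TSE"
    and f: "(f has_vector_derivative (- \<i>) *\<^sub>C r') (at 0)"
    and c: "\<And>t. c t \<in> Pi I H" and y: "y \<in> Pi I H"
    and der: "\<And>k. k \<in> I \<Longrightarrow> ((\<lambda>t. c t k) has_vector_derivative (- \<i>) *\<^sub>C y k) (at 0)"
  shows "((\<lambda>t. exp (- \<i> * complex_of_real \<epsilon> * complex_of_real t) *\<^sub>C TSE s (TRO (f t) (TO (c t))))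
    has_vector_derivative (- \<i>) *\<^sub>C (\<epsilon> *\<^sub>R TSE s (TRO (f 0) (TO (c 0))) + TSE s (TRO r' (TO (c 0))) +
      (\<Sum>k\<in>I. TSE s (TRO (f 0) (TO ((c 0)(k := y k))))))) (at 0)"
proof -
  interpret TRO: bounded_bilinear TRO by (rule hilbert_tensor_bounded_bilinear[OF TRO])
  interpret TSE: bounded_bilinear TSE by (rule hilbert_tensor_bounded_bilinear[OF TSE])
  have iy: "(\<lambda>k. (- \<i>) *\<^sub>C y k) \<in> Pi I H"
    using y H by (auto simp: closed_csubspace_def Pi_iff)
  have "((\<lambda>t. TO (c t)) has_vector_derivative (\<Sum>k\<in>I. TO ((c 0)(k := (- \<i>) *\<^sub>C y k)))) (at 0)"
    by (rule tensor_family_has_vector_derivative[OF TO I H c iy der])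
  moreover have "TO ((c 0)(k := (- \<i>) *\<^sub>C y k)) = (- \<i>) *\<^sub>C TO ((c 0)(k := y k))" if "k \<in> I" for k
    by (rule tensor_family_scaleC[OF TO c that Pi_mem[OF y that]])
  ultimately have "((\<lambda>t. TO (c t)) has_vector_derivative (- \<i>) *\<^sub>C (\<Sum>k\<in>I. TO ((c 0)(k := y k)))) (at 0)"
    by (simp add: scaleC_sum_right del: fun_upd_apply)
  from TRO.has_vector_derivative[OF f this]
  have "((\<lambda>t. TRO (f t) (TO (c t))) has_vector_derivative
      (- \<i>) *\<^sub>C (TRO r' (TO (c 0)) + (\<Sum>k\<in>I. TRO (f 0) (TO ((c 0)(k := y k)))))) (at 0)"
    by (simp add: hilbert_tensorD(3,4)[OF TRO] TRO.sum_right scaleC_add_right add.commute del: fun_upd_apply)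
  from bounded_linear.has_vector_derivative[OF TSE.bounded_linear_right[of s] this]
  have 1: "((\<lambda>t. TSE s (TRO (f t) (TO (c t)))) has_vector_derivative
      (- \<i>) *\<^sub>C (TSE s (TRO r' (TO (c 0))) + (\<Sum>k\<in>I. TSE s (TRO (f 0) (TO ((c 0)(k := y k)))))))
      (at 0)"
    by (simp add: hilbert_tensorD(4)[OF TSE] TSE.add_right TSE.sum_right del: fun_upd_apply)
  have "((\<lambda>z. exp (- \<i> * complex_of_real \<epsilon> * z)) has_field_derivative
      exp (- \<i> * complex_of_real \<epsilon> * of_real 0) * (- \<i> * complex_of_real \<epsilon>)) (at (of_real 0))"
    by (auto intro!: derivative_eq_intros)
  from has_vector_derivative_real_field[OF this]
  have 2: "((\<lambda>t. exp (- \<i> * complex_of_real \<epsilon> * complex_of_real t)) has_vector_derivative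
      (- \<i> * complex_of_real \<epsilon>)) (at 0)"
    by simp
  from bounded_bilinear.has_vector_derivative[OF bounded_bilinear_scaleC 2 1]
  show ?thesis
    by (simp add: scaleR_scaleC scaleC_scaleC scaleC_add_right add_ac del: fun_upd_apply)
qed

text \<open>At time 0 both sides have derivative \<open>(- \<i>) *\<^sub>C G\<close>. Every later
  time reduces to this one: the evolved factors are again domain vectors, and the curve restarted
  from them is the old curve up to a phase.\<close>

lemma dephasing_evolution_graph:
  fixes \<epsilon> :: "'i \<Rightarrow> real"
    and TSE :: "'s::chilbert_space \<Rightarrow> 'e::chilbert_space \<Rightarrow> 't::chilbert_space"
  assumes TO: "hilbert_tensor_family I H TO" and I: "finite I"
    and H: "\<And>k. k \<in> I \<Longrightarrow> closed_csubspace (H k)"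
    and TRO: "hilbert_tensor TRO" and TSE: "hilbert_tensor TSE"
    and unot: "evolution_on UNIV (Vnot i) unot"
    and u: "\<And>k. k \<in> I \<Longrightarrow> evolution_on (H k) (V i k) (u k)"
    and U: "evolution_on UNIV (dephasing_hamiltonian J ket I TO TRO TSE \<epsilon> Vnot V) U"
    and i: "i \<in> J" and r: "(r, r') \<in> Vnot i" and x: "\<And>k. k \<in> I \<Longrightarrow> (x k, y k) \<in> V i k"
  shows "U t (TSE (ket i) (TRO r (TO x))) =
    exp (- \<i> * complex_of_real (\<epsilon> i) * complex_of_real t) *\<^sub>C
      TSE (ket i) (TRO (unot t r) (TO (\<lambda>k. u k t (x k))))"
proof -
  define E where "E t = exp (- \<i> * complex_of_real (\<epsilon> i) * complex_of_real t)" for t :: real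
  define \<phi> where "\<phi> r x t = E t *\<^sub>C TSE (ket i) (TRO (unot t r) (TO (\<lambda>k. u k t (x k))))" for r x t
  define G where "G r r' x y = \<epsilon> i *\<^sub>R TSE (ket i) (TRO r (TO x)) + TSE (ket i) (TRO r' (TO x)) +
    (\<Sum>k\<in>I. TSE (ket i) (TRO r (TO (x(k := y k)))))" for r r' x y
  have ugnot: "unitary_group_on UNIV unot" and ug: "\<And>k. k \<in> I \<Longrightarrow> unitary_group_on (H k) (u k)"
    and UG: "unitary_group_on UNIV U"
    using unot u U by (auto simp: evolution_on_def)
  have Vnot_D: "((\<lambda>t. unot t r) has_vector_derivative (- \<i>) *\<^sub>C r') (at 0)" if "(r, r') \<in> Vnot i" for r r'
    using unot that by (auto simp: evolution_on_def)
  have V_D: "x \<in> H k \<and> y \<in> H k \<and> ((\<lambda>t. u k t x) has_vector_derivative (- \<i>) *\<^sub>C y) (at 0)"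
    if "k \<in> I" "(x, y) \<in> V i k" for k x y
    using u[OF that(1)] that(2) by (auto simp: evolution_on_def)
  have E_add: "E (s + h) = E s * E h" for s h
    by (simp add: E_def exp_add[symmetric] algebra_simps)
  have \<phi>0: "\<phi> r x 0 = TSE (ket i) (TRO r (TO x))" if "x \<in> Pi I H" for r x
    using that tensor_family_cong[OF TO that, of "\<lambda>k. u k 0 (x k)"]
    by (simp add: \<phi>_def E_def unitary_group_0[OF _ ugnot] unitary_group_0[OF H ug] Pi_iff)
  have main: "(\<phi> r x has_vector_derivative (- \<i>) *\<^sub>C G r r' x y) (at 0)"
    "((\<lambda>t. U t (TSE (ket i) (TRO r (TO x)))) has_vector_derivative (- \<i>) *\<^sub>C G r r' x y) (at 0)"
    if r: "(r, r') \<in> Vnot i" and xy: "\<And>k. k \<in> I \<Longrightarrow> (x k, y k) \<in> V i k" for r r' x y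
  proof -
    have xH: "x \<in> Pi I H" and yH: "y \<in> Pi I H" using V_D[OF _ xy] by auto
    have c: "(\<lambda>k. u k t (x k)) \<in> Pi I H" for t
      using xH unitary_group_mem[OF H ug] by (auto simp: Pi_iff)
    have eq: "TO ((\<lambda>k. u k 0 (x k))(j := y j)) = TO (x(j := y j))" if "j \<in> I" for j
      by (rule tensor_family_cong[OF TO]) (use xH yH that unitary_group_0[OF H ug] in \<open>auto simp: Pi_iff\<close>)
    have eq0: "TO (\<lambda>k. u k 0 (x k)) = TO x"
      by (rule tensor_family_cong[OF TO xH]) (use xH unitary_group_0[OF H ug] in \<open>auto simp: Pi_iff\<close>)
    have "(\<phi> r x has_vector_derivative (- \<i>) *\<^sub>C (\<epsilon> i *\<^sub>R TSE (ket i) (TRO (unot 0 r) (TO (\<lambda>k. u k 0 (x k)))) +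
        TSE (ket i) (TRO r' (TO (\<lambda>k. u k 0 (x k)))) +
        (\<Sum>j\<in>I. TSE (ket i) (TRO (unot 0 r) (TO ((\<lambda>k. u k 0 (x k))(j := y j))))))) (at 0)"
      unfolding \<phi>_def E_def
      by (rule has_vector_derivative_product_curve[OF TO I H TRO TSE Vnot_D[OF r] c yH])
        (use V_D[OF _ xy] in auto)
    then show "(\<phi> r x has_vector_derivative (- \<i>) *\<^sub>C G r r' x y) (at 0)"
      by (simp add: G_def eq eq0 unitary_group_0[OF _ ugnot] del: fun_upd_apply)
    \<comment> \<open>The pair is one of the generators spanning the Hamiltonian's graph, so the
      derivative of \<open>U\<close> on it is known by definition of
      \<open>evolution_on\<close>.\<close>
    have "(TSE (ket i) (TRO r (TO x)), G r r' x y) \<in> dephasing_hamiltonian J ket I TO TRO TSE \<epsilon> Vnot V"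
      unfolding dephasing_hamiltonian_def G_def
      by (rule subsetD[OF closure_subset], rule span_base) (use i r xy in blast)
    then show "((\<lambda>t. U t (TSE (ket i) (TRO r (TO x)))) has_vector_derivative (- \<i>) *\<^sub>C G r r' x y) (at 0)"
      using U by (auto simp: evolution_on_def)
  qed
  have xH: "x \<in> Pi I H" using V_D[OF _ x] by auto
  define xs where "xs s k = u k s (x k)" for s k
  define ys where "ys s k = u k s (y k)" for s k
  have rs: "(unot s r, unot s r') \<in> Vnot i" for s
    by (rule evolution_on_graph_invariant[OF _ unot r]) simp
  have xys: "(xs s k, ys s k) \<in> V i k" if "k \<in> I" for s k
    unfolding xs_def ys_def by (rule evolution_on_graph_invariant[OF H u x]) (fact that)+
  have xsH: "xs s \<in> Pi I H" for s using V_D[OF _ xys] by auto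
  \<comment> \<open>The group laws of all factors move time \<open>s\<close> into the initial data,
    so derivatives at 0 are enough.\<close>
  have shift: "\<phi> r x (s + h) = E s *\<^sub>C \<phi> (unot s r) (xs s) h" for s h
  proof -
    have "TO (\<lambda>k. u k (s + h) (x k)) = TO (\<lambda>k. u k h (xs s k))"
    proof (rule tensor_family_cong[OF TO])
      show "(\<lambda>k. u k h (xs s k)) \<in> Pi I H"
        using xsH[of s] unitary_group_mem[OF H ug] by (auto simp: Pi_iff)
      show "u k (s + h) (x k) = u k h (xs s k)" if "k \<in> I" for k
        using unitary_group_add[OF H[OF that] ug[OF that], of "x k" h s] xH that
        by (simp add: xs_def add.commute Pi_iff)
    qed
    then show ?thesis
      using unitary_group_add[OF _ ugnot, of r h s]
      by (simp add: \<phi>_def E_add scaleC_scaleC add.commute mult.commute)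
  qed
  define D where "D s = E s *\<^sub>C (- \<i>) *\<^sub>C G (unot s r) (unot s r') (xs s) (ys s)" for s
  have scale: "bounded_linear (\<lambda>z. E s *\<^sub>C (z :: 't))" for s
    by (rule bounded_bilinear.bounded_linear_right[OF bounded_bilinear_scaleC])
  have "\<phi> r x t = U t (\<phi> r x 0)"
  proof (rule unitary_group_unique[OF UG])
    fix s
    show "((\<lambda>h. \<phi> r x (s + h)) has_vector_derivative D s) (at 0)"
      unfolding shift D_def
      by (rule bounded_linear.has_vector_derivative[OF scale main(1)[OF rs xys]])
    have "\<phi> r x s = E s *\<^sub>C TSE (ket i) (TRO (unot s r) (TO (xs s)))"
      using shift[of s 0] \<phi>0[OF xsH] by simp
    then have "U h (\<phi> r x s) = E s *\<^sub>C U h (TSE (ket i) (TRO (unot s r) (TO (xs s))))" for h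
      by (simp add: unitary_group_linear(2)[OF _ UG])
    then show "((\<lambda>h. U h (\<phi> r x s)) has_vector_derivative D s) (at 0)"
      unfolding D_def
      by (simp only:) (rule bounded_linear.has_vector_derivative[OF scale main(2)[OF rs xys]])
  qed
  then show ?thesis
    using \<phi>0[OF xH] by (simp add: \<phi>_def E_def)
qed

text \<open>Self-adjoint operators are densely defined, so every factor is a limit of domain
  vectors; both sides of the formula are continuous along such limits.\<close>

lemma dephasing_evolution_product:
  fixes \<epsilon> :: "'i \<Rightarrow> real"
  assumes TO: "hilbert_tensor_family I H TO" and I: "finite I"
    and H: "\<And>k. k \<in> I \<Longrightarrow> closed_csubspace (H k)"
    and TRO: "hilbert_tensor TRO" and TSE: "hilbert_tensor TSE"
    and Vnot: "self_adjoint_on UNIV (Vnot i)" and V: "\<And>k. k \<in> I \<Longrightarrow> self_adjoint_on (H k) (V i k)"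
    and unot: "evolution_on UNIV (Vnot i) unot"
    and u: "\<And>k. k \<in> I \<Longrightarrow> evolution_on (H k) (V i k) (u k)"
    and U: "evolution_on UNIV (dephasing_hamiltonian J ket I TO TRO TSE \<epsilon> Vnot V) U"
    and i: "i \<in> J" and x: "x \<in> Pi I H"
  shows "U t (TSE (ket i) (TRO r (TO x))) =
    exp (- \<i> * complex_of_real (\<epsilon> i) * complex_of_real t) *\<^sub>C
      TSE (ket i) (TRO (unot t r) (TO (\<lambda>k. u k t (x k))))"
proof -
  have ugnot: "unitary_group_on UNIV unot" and ug: "\<And>k. k \<in> I \<Longrightarrow> unitary_group_on (H k) (u k)"
    and UG: "unitary_group_on UNIV U"
    using unot u U by (auto simp: evolution_on_def)
  have "r \<in> closure (Domain (Vnot i))"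
    using Vnot by (auto simp: self_adjoint_on_def)
  then obtain rn where rn: "\<And>n. rn n \<in> Domain (Vnot i)" "rn \<longlonglongrightarrow> r"
    unfolding closure_sequential by blast
  have "\<exists>xn. (\<forall>n. xn n \<in> Domain (V i k)) \<and> xn \<longlonglongrightarrow> x k" if "k \<in> I" for k
  proof -
    have "x k \<in> closure (Domain (V i k))"
      using V[OF that] x that by (auto simp: self_adjoint_on_def Pi_iff)
    then show ?thesis unfolding closure_sequential by blast
  qed
  then obtain xn where xn: "\<And>k n. k \<in> I \<Longrightarrow> xn k n \<in> Domain (V i k)" "\<And>k. k \<in> I \<Longrightarrow> xn k \<longlonglongrightarrow> x k"
    by metis
  have xnH: "xn k n \<in> H k" if "k \<in> I" for k n
    using xn(1)[OF that] V[OF that] by (auto simp: self_adjoint_on_def)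
  define L where "L n = TSE (ket i) (TRO (rn n) (TO (\<lambda>k. xn k n)))" for n
  define R where "R n = exp (- \<i> * complex_of_real (\<epsilon> i) * complex_of_real t) *\<^sub>C
      TSE (ket i) (TRO (unot t (rn n)) (TO (\<lambda>k. u k t (xn k n))))" for n
  have LR: "U t (L n) = R n" for n
  proof -
    obtain r' where r': "(rn n, r') \<in> Vnot i" using rn(1)[of n] by blast
    obtain y where y: "\<And>k. k \<in> I \<Longrightarrow> (xn k n, y k) \<in> V i k"
      using xn(1)[of _ n] unfolding Domain_iff by metis
    show ?thesis
      unfolding L_def R_def
      using dephasing_evolution_graph[where x = "\<lambda>k. xn k n" and y = y, OF TO I H TRO TSE unot u U i r' y]
      by simp
  qed
  note bilin = bounded_bilinear.tendsto[OF hilbert_tensor_bounded_bilinear]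
  have "L \<longlonglongrightarrow> TSE (ket i) (TRO r (TO x))"
    unfolding L_def
    by (intro bilin[OF TSE] bilin[OF TRO] tendsto_const rn tensor_family_tendsto[OF TO _ x] xn)
      (use xnH in auto)
  from unitary_group_tendsto[OF _ UG _ _ this, of t]
  have "(\<lambda>n. U t (L n)) \<longlonglongrightarrow> U t (TSE (ket i) (TRO r (TO x)))" by simp
  moreover have "R \<longlonglongrightarrow> exp (- \<i> * complex_of_real (\<epsilon> i) * complex_of_real t) *\<^sub>C
      TSE (ket i) (TRO (unot t r) (TO (\<lambda>k. u k t (x k))))"
    unfolding R_def
  proof (intro tendsto_scaleC bilin[OF TSE] bilin[OF TRO] tendsto_const tensor_family_tendsto[OF TO])
    show "(\<lambda>n. unot t (rn n)) \<longlonglongrightarrow> unot t r"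
      by (rule unitary_group_tendsto[OF _ ugnot _ _ rn(2)]) auto
    show "(\<lambda>k. u k t (xn k n)) \<in> Pi I H" for n
      using unitary_group_mem[OF H ug] xnH by auto
    show "(\<lambda>k. u k t (x k)) \<in> Pi I H"
      using unitary_group_mem[OF H ug] x by (auto simp: Pi_iff)
    show "(\<lambda>n. u k t (xn k n)) \<longlonglongrightarrow> u k t (x k)" if "k \<in> I" for k
      by (rule unitary_group_tendsto[OF H ug _ _ xn(2)]) (use xnH x that in \<open>auto simp: Pi_iff\<close>)
  qed
  ultimately show ?thesis
    using LIMSEQ_unique LR by auto
qed

section \<open>Pointer blocks invariant under the evolution\<close>

lemma dense_subset_closed_subspace:
  assumes "closed M" "subspace M" "G \<subseteq> M" "closure (span G) = UNIV"
  shows "x \<in> M"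
  using assms closure_minimal[of "span G" M] span_minimal[of G M] by auto

text \<open>For a unit vector \<open>s\<close> the block \<open>range (TSE s)\<close> is an
  isometric image of a complete space, hence closed. Its preimages are closed subspaces, so
  invariance spreads by density from product vectors to the observed factor and then to the whole
  environment.\<close>

lemma evolution_preserves_block:
  assumes TO: "hilbert_tensor_family I H TO" and TRO: "hilbert_tensor TRO"
    and TSE: "hilbert_tensor TSE" and UG: "unitary_group_on UNIV U" and s: "norm s = 1"
    and prod: "\<And>r x. x \<in> Pi I H \<Longrightarrow> U t (TSE s (TRO r (TO x))) \<in> range (TSE s)"
  shows "U t (TSE s e) \<in> range (TSE s)"
proof -
  interpret TRO: bounded_bilinear TRO by (rule hilbert_tensor_bounded_bilinear[OF TRO])
  interpret TSE: bounded_bilinear TSE by (rule hilbert_tensor_bounded_bilinear[OF TSE])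
  interpret U: bounded_linear "U t" by (rule unitary_group_bounded_linear[OF UG])
  have "complete (range (TSE s))"
    by (rule complete_isometric_image[of 1])
      (auto simp: TSE.bounded_linear_right hilbert_tensor_norm[OF TSE] s complete_UNIV)
  then have closed: "closed (range (TSE s))" by (rule complete_imp_closed)
  have sub: "subspace (range (TSE s))"
    using linear_subspace_image[OF bounded_linear.linear[OF TSE.bounded_linear_right] subspace_UNIV] .
  have preimage: "closed (f -` range (TSE s))" "subspace (f -` range (TSE s))" if "bounded_linear f"
    for f :: "'z::real_normed_vector \<Rightarrow> _"
    using that closed sub
    by (auto intro!: continuous_closed_vimage linear_continuous_at linear_subspace_vimage
        bounded_linear.linear)
  have "TRO r w \<in> (\<lambda>e. U t (TSE s e)) -` range (TSE s)" for r w
  proof -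
    have "bounded_linear (\<lambda>w. U t (TSE s (TRO r w)))"
      by (intro U.bounded_linear_axioms TSE.bounded_linear_right TRO.bounded_linear_right
          bounded_linear_compose[of "U t"] bounded_linear_compose[of "TSE s"])
    then have "w \<in> (\<lambda>w. U t (TSE s (TRO r w))) -` range (TSE s)"
      by (intro dense_subset_closed_subspace[OF preimage _ tensor_family_dense[OF TO]])
        (simp_all add: image_subset_iff prod)
    then show ?thesis by simp
  qed
  moreover have "bounded_linear (\<lambda>e. U t (TSE s e))"
    by (intro U.bounded_linear_axioms TSE.bounded_linear_right bounded_linear_compose[of "U t"])
  ultimately have "e \<in> (\<lambda>e. U t (TSE s e)) -` range (TSE s)"
    by (intro dense_subset_closed_subspace[OF preimage _ hilbert_tensorD(6)[OF TRO]]) auto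
  then show ?thesis by simp
qed


section \<open>Consequences of separability\<close>

lemma sum_sqrt_mult_le:
  fixes f g p :: "'i \<Rightarrow> real"
  assumes "\<And>i. i \<in> A \<Longrightarrow> 0 \<le> p i" "\<And>i. i \<in> A \<Longrightarrow> 0 \<le> f i" "\<And>i. i \<in> A \<Longrightarrow> 0 \<le> g i"
  shows "(\<Sum>i\<in>A. p i * sqrt (f i * g i))\<^sup>2 \<le> (\<Sum>i\<in>A. p i * f i) * (\<Sum>i\<in>A. p i * g i)"
proof -
  have "(\<Sum>i\<in>A. sqrt (p i * f i) * sqrt (p i * g i))\<^sup>2 \<le>
      (\<Sum>i\<in>A. (sqrt (p i * f i))\<^sup>2) * (\<Sum>i\<in>A. (sqrt (p i * g i))\<^sup>2)"
    by (rule Cauchy_Schwarz_ineq_sum)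
  moreover have "sqrt (p i * f i) * sqrt (p i * g i) = p i * sqrt (f i * g i)" if "i \<in> A" for i
    using assms that by (simp add: real_sqrt_mult)
  ultimately show ?thesis using assms by simp
qed

lemma product_state_cinner:
  assumes T: "hilbert_tensor T" and C: "tensor_op T \<alpha> \<beta> C"
  shows "cinner (T s e) (C (T s' e')) = cinner s (\<alpha> s') * cinner e (\<beta> e')"
  using C by (simp add: tensor_op_def hilbert_tensorD(5)[OF T])

text \<open>Matrix elements factor, so Cauchy-Schwarz applies to \<open>\<alpha>\<close> and
  \<open>\<beta>\<close> separately; the four resulting diagonal values can then be paired
  crosswise.\<close>

lemma product_state_partial_transpose:
  assumes T: "hilbert_tensor T" and C: "product_state T C"
  shows "cinner (T s e) (C (T s e)) \<in> \<real>\<^sub>\<ge>\<^sub>0"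
    "(cmod (cinner (T s e) (C (T s' e'))))\<^sup>2 \<le>
      Re (cinner (T s' e) (C (T s' e))) * Re (cinner (T s e') (C (T s e')))"
proof -
  obtain \<alpha> \<beta> where \<alpha>: "positive_op_on UNIV \<alpha>" and \<beta>: "positive_op_on UNIV \<beta>"
    and C: "tensor_op T \<alpha> \<beta> C"
    using C by (auto simp: product_state_def density_on_def)
  note [simp] = product_state_cinner[OF T C]
  have \<alpha>\<beta>: "cinner s (\<alpha> s) \<in> \<real>\<^sub>\<ge>\<^sub>0" "cinner e (\<beta> e) \<in> \<real>\<^sub>\<ge>\<^sub>0" for s e
    using \<alpha> \<beta> by (auto simp: positive_op_on_def)
  then show "cinner (T s e) (C (T s e)) \<in> \<real>\<^sub>\<ge>\<^sub>0" by simp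
  have Re_mult: "Re (cinner s (\<alpha> s) * cinner e (\<beta> e)) = Re (cinner s (\<alpha> s)) * Re (cinner e (\<beta> e))" for s e
    using \<alpha>\<beta> by (simp add: complex_nonneg_Reals_iff)
  have "(cmod (cinner (T s e) (C (T s' e'))))\<^sup>2 =
      (cmod (cinner s (\<alpha> s')))\<^sup>2 * (cmod (cinner e (\<beta> e')))\<^sup>2"
    by (simp add: norm_mult power_mult_distrib)
  also have "\<dots> \<le> (Re (cinner s (\<alpha> s)) * Re (cinner s' (\<alpha> s'))) * (Re (cinner e (\<beta> e)) * Re (cinner e' (\<beta> e')))"
    using \<alpha>\<beta> by (intro mult_mono positive_op_Cauchy_Schwarz \<alpha> \<beta>) (auto simp: complex_nonneg_Reals_iff)
  also have "\<dots> = Re (cinner (T s' e) (C (T s' e))) * Re (cinner (T s e') (C (T s e')))"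
    by (simp only: product_state_cinner[OF T C] Re_mult mult_ac)
  finally show "(cmod (cinner (T s e) (C (T s' e'))))\<^sup>2 \<le>
      Re (cinner (T s' e) (C (T s' e))) * Re (cinner (T s e') (C (T s e')))" .
qed

text \<open>The triangle inequality bounds the matrix element by a weighted sum of geometric means;
  Cauchy-Schwarz over the mixture index restores the product of the two averages.\<close>

lemma product_state_mixture_partial_transpose:
  assumes T: "hilbert_tensor T" and \<tau>: "product_state_mixture T \<tau>"
  shows "cinner (T s e) (\<tau> (T s e)) \<in> \<real>\<^sub>\<ge>\<^sub>0"
    "(cmod (cinner (T s e) (\<tau> (T s' e'))))\<^sup>2 \<le>
      Re (cinner (T s' e) (\<tau> (T s' e))) * Re (cinner (T s e') (\<tau> (T s e')))"
proof -
  obtain n :: nat and p C where p: "\<And>j. j < n \<Longrightarrow> 0 \<le> p j"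
    and C: "\<And>j. j < n \<Longrightarrow> product_state T (C j)"
    and \<tau>: "\<tau> = (\<lambda>x. \<Sum>j<n. p j *\<^sub>R C j x)"
    using \<tau> by (auto simp: product_state_mixture_def)
  note C = product_state_partial_transpose[OF T C]
  have \<tau>_cinner: "cinner x (\<tau> y) = (\<Sum>j<n. p j *\<^sub>R cinner x (C j y))" for x y
    by (simp add: \<tau> cinner_sum_right cinner_scaleR_right scaleR_conv_of_real)
  show nn: "cinner (T s e) (\<tau> (T s e)) \<in> \<real>\<^sub>\<ge>\<^sub>0" for s e
    using p C(1) unfolding \<tau>_cinner
    by (auto simp: complex_nonneg_Reals_iff intro!: sum_nonneg sum.neutral)
  define f where "f j = Re (cinner (T s' e) (C j (T s' e)))" for j
  define g where "g j = Re (cinner (T s e') (C j (T s e')))" for j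
  have fg: "0 \<le> f j" "0 \<le> g j" if "j < n" for j
    using C(1)[OF that] by (auto simp: f_def g_def complex_nonneg_Reals_iff)
  have "cmod (cinner (T s e) (\<tau> (T s' e'))) \<le> (\<Sum>j<n. p j * sqrt (f j * g j))"
    unfolding \<tau>_cinner
  proof (rule sum_norm_le)
    fix j assume "j \<in> {..<n}"
    then have j: "j < n" by simp
    have "cmod (cinner (T s e) (C j (T s' e'))) \<le> sqrt (f j * g j)"
      using C(2)[OF j] unfolding f_def g_def by (rule real_le_rsqrt)
    then show "norm (p j *\<^sub>R cinner (T s e) (C j (T s' e'))) \<le> p j * sqrt (f j * g j)"
      using p[OF j] by (simp add: mult_left_mono)
  qed
  then have "(cmod (cinner (T s e) (\<tau> (T s' e'))))\<^sup>2 \<le> (\<Sum>j<n. p j * sqrt (f j * g j))\<^sup>2"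
    by (intro power_mono) auto
  also have "\<dots> \<le> (\<Sum>j<n. p j * f j) * (\<Sum>j<n. p j * g j)"
    by (rule sum_sqrt_mult_le) (use p fg in auto)
  also have "\<dots> = Re (cinner (T s' e) (\<tau> (T s' e))) * Re (cinner (T s e') (\<tau> (T s e')))"
    by (simp add: \<tau>_cinner f_def g_def)
  finally show "(cmod (cinner (T s e) (\<tau> (T s' e'))))\<^sup>2 \<le>
      Re (cinner (T s' e) (\<tau> (T s' e))) * Re (cinner (T s e') (\<tau> (T s e')))" .
qed

text \<open>
  In the second inequality the right-hand side has \<open>s\<close> and \<open>s'\<close> exchanged in comparison with
  Cauchy-Schwarz: it is the positivity of the partial transpose.
\<close>

lemma separable_state_partial_transpose:
  assumes T: "hilbert_tensor T" and \<sigma>: "separable_state T \<sigma>"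
  shows "cinner (T s e) (\<sigma> (T s e)) \<in> \<real>\<^sub>\<ge>\<^sub>0"
    "(cmod (cinner (T s e) (\<sigma> (T s' e'))))\<^sup>2 \<le>
      Re (cinner (T s' e) (\<sigma> (T s' e))) * Re (cinner (T s e') (\<sigma> (T s e')))"
proof -
  obtain \<tau> r where \<tau>: "\<And>n::nat. product_state_mixture T (\<tau> n)"
    and tn: "\<And>n. has_trace_norm (\<lambda>x. \<sigma> x - \<tau> n x) (r n)" and r: "r \<longlonglongrightarrow> 0"
    using \<sigma> by (auto simp: separable_state_def)
  note \<tau> = product_state_mixture_partial_transpose[OF T \<tau>]
  have lim: "(\<lambda>n. cinner x (\<tau> n y)) \<longlonglongrightarrow> cinner x (\<sigma> y)" for x y
  proof -
    have "(\<lambda>n. \<sigma> y - \<tau> n y) \<longlonglongrightarrow> 0"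
    proof (rule Lim_null_comparison)
      show "\<forall>\<^sub>F n in sequentially. norm (\<sigma> y - \<tau> n y) \<le> r n * norm y"
        using norm_le_has_trace_norm[OF tn] by simp
      show "(\<lambda>n. r n * norm y) \<longlonglongrightarrow> 0"
        using tendsto_mult_right[OF r, of "norm y"] by simp
    qed
    from tendsto_diff[OF tendsto_const[of "\<sigma> y"] this] have "(\<lambda>n. \<tau> n y) \<longlonglongrightarrow> \<sigma> y" by simp
    then show ?thesis by (intro tendsto_cinner tendsto_const)
  qed
  show "cinner (T s e) (\<sigma> (T s e)) \<in> \<real>\<^sub>\<ge>\<^sub>0"
    by (rule Lim_in_closed_set[OF closed_nonneg_Reals_complex _ _ lim]) (use \<tau>(1) in auto)
  show "(cmod (cinner (T s e) (\<sigma> (T s' e'))))\<^sup>2 \<le>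
      Re (cinner (T s' e) (\<sigma> (T s' e))) * Re (cinner (T s e') (\<sigma> (T s e')))"
  proof (rule LIMSEQ_le)
    show "(\<lambda>n. (cmod (cinner (T s e) (\<tau> n (T s' e'))))\<^sup>2) \<longlonglongrightarrow> (cmod (cinner (T s e) (\<sigma> (T s' e'))))\<^sup>2"
      by (intro tendsto_intros lim)
    show "(\<lambda>n. Re (cinner (T s' e) (\<tau> n (T s' e))) * Re (cinner (T s e') (\<tau> n (T s e')))) \<longlonglongrightarrow>
        Re (cinner (T s' e) (\<sigma> (T s' e))) * Re (cinner (T s e') (\<sigma> (T s e')))"
      by (intro tendsto_intros lim)
  qed (use \<tau>(2) in auto)
qed

text \<open>Log-convexity makes successive ratios nondecreasing, so an initial ratio
  \<open>c > 1\<close> would force geometric growth past \<open>K\<close>.\<close>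

lemma bounded_log_convex_le:
  fixes b :: "nat \<Rightarrow> real"
  assumes nonneg: "\<And>n. 0 \<le> b n" and bound: "\<And>n. b n \<le> K"
    and log_convex: "\<And>n. (b (Suc n))\<^sup>2 \<le> b n * b (Suc (Suc n))"
  shows "b 1 \<le> b 0"
proof (rule ccontr)
  assume "\<not> b 1 \<le> b 0"
  then have less: "b 0 < b 1" by simp
  \<comment> \<open>If \<open>b 0\<close> were 0, log-convexity at 0 would give
    \<open>b 1 = 0\<close>, against \<open>less\<close>.\<close>
  have b0: "b 0 > 0"
    using log_convex[of 0] less nonneg[of 0] by (cases "b 0 = 0") (auto simp: less_le)
  define c where "c = b 1 / b 0"
  have c: "c > 1" using less b0 by (simp add: c_def)
  have step: "0 < b n \<and> c * b n \<le> b (Suc n)" for n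
  proof (induction n)
    case 0
    then show ?case using b0 by (simp add: c_def)
  next
    case (Suc n)
    then have pos: "0 < b (Suc n)" using c by (smt (verit) mult_pos_pos)
    have "c * b n * b (Suc n) \<le> b (Suc n) * b (Suc n)"
      using Suc pos by (intro mult_right_mono) auto
    also have "\<dots> \<le> b n * b (Suc (Suc n))"
      using log_convex[of n] by (simp add: power2_eq_square)
    finally have "b n * (c * b (Suc n)) \<le> b n * b (Suc (Suc n))"
      by (simp add: mult_ac)
    then show ?case using Suc pos by simp
  qed
  have grow: "c ^ n * b 0 \<le> b n" for n
  proof (induction n)
    case (Suc n)
    then have "c * (c ^ n * b 0) \<le> c * b n" using c by (intro mult_left_mono) auto
    also have "\<dots> \<le> b (Suc n)" using step by blast
    finally show ?case by (simp add: mult_ac)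
  qed simp
  obtain n where "K / b 0 < c ^ n" using real_arch_pow[OF c] by blast
  then have "K < c ^ n * b 0" using b0 by (simp add: field_simps)
  with grow[of n] bound[of n] show False by linarith
qed

text \<open>The sequence is the form evaluated on the iterates of \<open>V\<close>, bounded since
  these keep the norm of \<open>e\<close>. Forward iterates give one inequality; the reverse one
  comes from the inverse map.\<close>

lemma quadratic_form_le_of_log_convex:
  assumes \<rho>: "bounded_op_on UNIV \<rho>" and nonneg: "\<And>e. cinner e (\<rho> e) \<in> \<real>\<^sub>\<ge>\<^sub>0"
    and V: "\<And>e. norm (V e) = norm e"
    and conv: "\<And>e. (Re (cinner (V e) (\<rho> (V e))))\<^sup>2 \<le>
      Re (cinner e (\<rho> e)) * Re (cinner (V (V e)) (\<rho> (V (V e))))"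
  shows "Re (cinner (V e) (\<rho> (V e))) \<le> Re (cinner e (\<rho> e))"
proof -
  obtain K where K: "\<And>x. norm (\<rho> x) \<le> K * norm x"
    using \<rho> by (auto simp: bounded_op_on_def)
  have norm: "norm ((V ^^ n) e) = norm e" for n
    by (induction n) (auto simp: V)
  have "Re (cinner ((V ^^ 1) e) (\<rho> ((V ^^ 1) e))) \<le> Re (cinner ((V ^^ 0) e) (\<rho> ((V ^^ 0) e)))"
  proof (rule bounded_log_convex_le)
    fix n
    show "0 \<le> Re (cinner ((V ^^ n) e) (\<rho> ((V ^^ n) e)))"
      using nonneg by (simp add: complex_nonneg_Reals_iff)
    have "Re (cinner ((V ^^ n) e) (\<rho> ((V ^^ n) e))) \<le> norm ((V ^^ n) e) * norm (\<rho> ((V ^^ n) e))"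
      using complex_Re_le_cmod cinner_Cauchy_Schwarz order_trans by blast
    also have "\<dots> \<le> norm e * (K * norm e)"
      using K[of "(V ^^ n) e"] by (simp add: norm mult_left_mono)
    finally show "Re (cinner ((V ^^ n) e) (\<rho> ((V ^^ n) e))) \<le> norm e * (K * norm e)" .
  qed (simp add: conv)
  then show ?thesis by simp
qed

text \<open>
  Here \<open>v0\<close> and \<open>v1\<close> are the inverse conditional evolutions. With \<open>V = v1 \<circ> w0\<close>, positivity of
  the partial transpose says that \<open>n \<mapsto> \<langle>V\<^sup>n e, \<rho> (V\<^sup>n e)\<rangle>\<close> is log-convex over all
  integers \<open>n\<close>; being bounded, it is constant.
\<close>

lemma conditional_states_eq:
  assumes \<rho>: "bounded_op_on UNIV \<rho>" and nonneg: "\<And>e. cinner e (\<rho> e) \<in> \<real>\<^sub>\<ge>\<^sub>0"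
    and inv: "\<And>e. v0 (w0 e) = e" "\<And>e. w0 (v0 e) = e" "\<And>e. v1 (w1 e) = e" "\<And>e. w1 (v1 e) = e"
    and norm: "\<And>e. norm (v0 e) = norm e" "\<And>e. norm (v1 e) = norm e"
    and ppt: "\<And>e f. (cmod (cinner (v1 e) (\<rho> (v0 f))))\<^sup>2 \<le>
      Re (cinner (v0 e) (\<rho> (v0 e))) * Re (cinner (v1 f) (\<rho> (v1 f)))"
  shows "cinner (v0 e) (\<rho> (v0 e)) = cinner (v1 e) (\<rho> (v1 e))"
proof -
  have norm': "norm (w0 e) = norm e" "norm (w1 e) = norm e" for e
    using norm(1)[of "w0 e"] norm(2)[of "w1 e"] by (simp_all add: inv)
  have Re_le: "(Re z)\<^sup>2 \<le> (cmod z)\<^sup>2" for z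
    using power_mono[OF abs_Re_le_cmod[of z], of 2] by simp
  \<comment> \<open>With \<open>V = v1 \<circ> w0\<close>, the instance of \<open>ppt\<close> at
    \<open>w0 f\<close> and \<open>w0 (V f)\<close> has \<open>V f\<close> on both sides of the
    matrix element, and \<open>f\<close> and \<open>V (V f)\<close> in the diagonal terms.\<close>
  have "Re (cinner (v1 (w0 e)) (\<rho> (v1 (w0 e)))) \<le> Re (cinner e (\<rho> e))" for e
    by (rule quadratic_form_le_of_log_convex[OF \<rho> nonneg, where V = "\<lambda>e. v1 (w0 e)"])
      (use ppt[of "w0 f" "w0 (v1 (w0 f))" for f] in \<open>auto simp: inv norm norm' intro: order_trans[OF Re_le]\<close>)
  from this[of "v0 e"] have 1: "Re (cinner (v1 e) (\<rho> (v1 e))) \<le> Re (cinner (v0 e) (\<rho> (v0 e)))"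
    by (simp add: inv)
  \<comment> \<open>The same for the inverse map \<open>v0 \<circ> w1\<close>, with the roles of the
    two arguments of \<open>ppt\<close> exchanged.\<close>
  have "Re (cinner (v0 (w1 e)) (\<rho> (v0 (w1 e)))) \<le> Re (cinner e (\<rho> e))" for e
    by (rule quadratic_form_le_of_log_convex[OF \<rho> nonneg, where V = "\<lambda>e. v0 (w1 e)"])
      (use ppt[of "w1 (v0 (w1 f))" "w1 f" for f] in
        \<open>auto simp: inv norm norm' mult.commute intro: order_trans[OF Re_le]\<close>)
  from this[of "v1 e"] have "Re (cinner (v0 e) (\<rho> (v0 e))) \<le> Re (cinner (v1 e) (\<rho> (v1 e)))"
    by (simp add: inv)
  with 1 nonneg show ?thesis
    by (auto simp: complex_eq_iff complex_nonneg_Reals_iff)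
qed

text \<open>Each diagonal block is the squared modulus of its amplitude times a conditional form,
  and the two forms agree. Crosswise weights state this without division.\<close>

lemma separable_dephasing_blocks_eq:
  assumes TSE: "hilbert_tensor TSE" and UG: "unitary_group_on UNIV U"
    and ket: "cinner (ket i) (ket i) = 1" "cinner (ket j) (ket j) = 1"
      "cinner (ket i) (ket j) = 0" "cinner (ket j) (ket i) = 0"
    and block: "\<And>l t e. l \<in> {i, j} \<Longrightarrow> U t (TSE (ket l) e) \<in> range (TSE (ket l))"
    and \<psi>: "\<psi> = a i *\<^sub>C ket i + a j *\<^sub>C ket j" "a i \<noteq> 0" "a j \<noteq> 0"
    and \<sigma>0: "tensor_op TSE (ketbra \<psi> \<psi>) \<rho> \<sigma>0" and \<rho>: "bounded_op_on UNIV \<rho>"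
    and \<sigma>: "\<sigma> = U t \<circ> \<sigma>0 \<circ> cadjoint (U t)" and sep: "separable_state TSE \<sigma>"
  shows "(cmod (a j))\<^sup>2 * cinner (TSE (ket i) e) (\<sigma> (TSE (ket i) e')) =
    (cmod (a i))\<^sup>2 * cinner (TSE (ket j) e) (\<sigma> (TSE (ket j) e'))"
proof -
  have ket1: "cinner (ket l) (ket l) = 1" if "l \<in> {i, j}" for l
    using ket that by auto
  \<comment> \<open>Invariance of the block gives the conditional evolution. It inherits isometry
    and inverses from \<open>U\<close> because \<open>TSE (ket l)\<close> is isometric.\<close>
  define w where "w l t e = (SOME e'. U t (TSE (ket l) e) = TSE (ket l) e')" for l t e
  have w: "U t (TSE (ket l) e) = TSE (ket l) (w l t e)" if "l \<in> {i, j}" for l t e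
    using block[OF that, of t e] unfolding w_def by (auto intro: someI)
  \<comment> \<open>The state evolves by conjugation with \<open>U t\<close>, so its matrix elements
    meet the initial state through the inverse evolutions.\<close>
  define v where "v l = w l (- t)" for l
  have TSE_cinner: "cinner (TSE (ket l) e) (TSE (ket l) e') = cinner e e'" if "l \<in> {i, j}" for l e e'
    by (simp add: hilbert_tensorD(5)[OF TSE] ket1[OF that])
  have w_cinner: "cinner (w l t e) (w l t e') = cinner e e'" if "l \<in> {i, j}" for l t e e'
    using unitary_group_cinner[OF _ UG, of "TSE (ket l) e" "TSE (ket l) e'" t]
    by (simp add: w[OF that] TSE_cinner[OF that])
  have inj: "e = e'" if "l \<in> {i, j}" "TSE (ket l) e = TSE (ket l) e'" for l e e'
    using that TSE_cinner by (metis cinner_eqI)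
  have inverse: "w l t (v l e) = e" "v l (w l t e) = e" if "l \<in> {i, j}" for l e
    using unitary_group_inverse[OF _ UG, of "TSE (ket l) e" t] inj[OF that]
    by (simp_all add: v_def w[OF that])
  have v_norm: "norm (v l e) = norm e" if "l \<in> {i, j}" for l e
    using w_cinner[OF that, of "- t" e e] by (simp add: v_def cinner_self flip: of_real_power)
  have \<psi>_cinner: "cinner (ket l) \<psi> = a l" "cinner \<psi> (ket l) = cnj (a l)" if "l \<in> {i, j}" for l
    using that ket by (auto simp: \<psi> cinner_add_right cinner_add_left cinner_scaleC_right cinner_scaleC_left)
  have \<sigma>_cinner: "cinner (TSE (ket l) e) (\<sigma> (TSE (ket m) e')) = a l * cnj (a m) * cinner (v l e) (\<rho> (v m e'))"
    if lm: "l \<in> {i, j}" "m \<in> {i, j}" for l m e e'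
  proof -
    have "cinner (TSE (ket l) e) (\<sigma> (TSE (ket m) e')) =
        cinner (U t (TSE (ket l) (v l e))) (U t (\<sigma>0 (TSE (ket m) (v m e'))))"
      by (simp add: \<sigma> cadjoint_unitary_group[OF UG] w[OF lm(1)] w[OF lm(2)] inverse[OF lm(1)] flip: v_def)
    also have "\<dots> = cinner (TSE (ket l) (v l e)) (\<sigma>0 (TSE (ket m) (v m e')))"
      by (rule unitary_group_cinner[OF _ UG]) auto
    also have "\<dots> = a l * cnj (a m) * cinner (v l e) (\<rho> (v m e'))"
      using \<sigma>0 \<psi>_cinner[OF lm(1)] \<psi>_cinner[OF lm(2)]
      by (simp add: product_state_cinner[OF TSE \<sigma>0] ketbra_def cinner_scaleC_right mult_ac)
    finally show ?thesis .
  qed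
  have a_pos: "0 < (cmod (a l))\<^sup>2" if "l \<in> {i, j}" for l using \<psi> that by auto
  have diag: "cinner (TSE (ket l) e) (\<sigma> (TSE (ket l) e)) = (cmod (a l))\<^sup>2 * cinner (v l e) (\<rho> (v l e))"
    if "l \<in> {i, j}" for l e
    unfolding \<sigma>_cinner[OF that that] complex_norm_square ..
  note ppt = separable_state_partial_transpose[OF TSE sep]
  \<comment> \<open>Of \<rho> only boundedness is assumed; its positivity is read off from the
    diagonal block of the separable state.\<close>
  have nonneg: "cinner e (\<rho> e) \<in> \<real>\<^sub>\<ge>\<^sub>0" for e
  proof -
    have "(cmod (a i))\<^sup>2 * cinner e (\<rho> e) \<in> \<real>\<^sub>\<ge>\<^sub>0"
      using ppt(1)[of "ket i" "w i t e"] by (simp add: diag inverse)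
    then show ?thesis
      using a_pos[of i] by (auto simp: complex_nonneg_Reals_iff zero_le_mult_iff simp del: of_real_power)
  qed
  have cond: "cinner (v i e) (\<rho> (v i e)) = cinner (v j e) (\<rho> (v j e))" for e
  proof (rule conditional_states_eq[OF \<rho> nonneg, where ?v0.0 = "v i" and ?v1.0 = "v j" and ?w0.0 = "w i t" and ?w1.0 = "w j t"])
    fix e f
    \<comment> \<open>Both sides carry the product of the two squared amplitudes: on the left from
      the off-diagonal block, on the right from the exchanged diagonal blocks.\<close>
    have "(cmod (a j * cnj (a i) * cinner (v j e) (\<rho> (v i f))))\<^sup>2 \<le>
        ((cmod (a i))\<^sup>2 * Re (cinner (v i e) (\<rho> (v i e)))) * ((cmod (a j))\<^sup>2 * Re (cinner (v j f) (\<rho> (v j f))))"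
      using ppt(2)[of "ket j" e "ket i" f] by (simp add: diag \<sigma>_cinner del: of_real_power)
    then have "((cmod (a i))\<^sup>2 * (cmod (a j))\<^sup>2) * (cmod (cinner (v j e) (\<rho> (v i f))))\<^sup>2 \<le>
        ((cmod (a i))\<^sup>2 * (cmod (a j))\<^sup>2) * (Re (cinner (v i e) (\<rho> (v i e))) * Re (cinner (v j f) (\<rho> (v j f))))"
      by (simp add: norm_mult power_mult_distrib mult_ac)
    then show "(cmod (cinner (v j e) (\<rho> (v i f))))\<^sup>2 \<le>
        Re (cinner (v i e) (\<rho> (v i e))) * Re (cinner (v j f) (\<rho> (v j f)))"
      by (rule mult_left_le_imp_le) (use a_pos in simp)
  qed (simp_all add: inverse v_norm)
  define B where "B e e' = (cmod (a j))\<^sup>2 * cinner (TSE (ket i) e) (\<sigma> (TSE (ket i) e')) -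
    (cmod (a i))\<^sup>2 * cinner (TSE (ket j) e) (\<sigma> (TSE (ket j) e'))" for e e'
  have \<sigma>0': "bounded_op_on UNIV \<sigma>0" using \<sigma>0 by (simp add: tensor_op_def)
  have \<sigma>_lin: "\<sigma> (x + y) = \<sigma> x + \<sigma> y" "\<sigma> (c *\<^sub>C x) = c *\<^sub>C \<sigma> x" for x y c
    by (simp_all add: \<sigma> cadjoint_unitary_group[OF UG] unitary_group_linear[OF _ UG] bounded_opD[OF \<sigma>0'])
  \<comment> \<open>Agreement of the expectation values extends to all matrix elements by
    polarization.\<close>
  have "B e e' = 0"
  proof (rule sesquilinear_eq_0[where S = UNIV and B = B])
    show "B x x = 0" for x
      by (simp add: B_def diag cond del: of_real_power)
  qed (auto simp: B_def hilbert_tensorD[OF TSE] \<sigma>_lin cinner_add_left cinner_add_right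
      cinner_scaleC_left cinner_scaleC_right algebra_simps)
  then show ?thesis by (simp add: B_def)
qed


section \<open>Spectrum broadcast structure\<close>

text \<open>Proportional blocks make the conditional operator of nonzero weight a multiple of the
  other. Applying it once more yields zero by orthogonality, although its square is nonzero on a
  suitable product vector.\<close>

lemma sbs_state_not_proportional:
  assumes sbs: "sbs_state {i, j} ket I H TO TSO \<sigma>" and "i \<noteq> j"
    and ket: "cinner (ket i) (ket i) = 1" "cinner (ket j) (ket j) = 1"
      "cinner (ket i) (ket j) = 0" "cinner (ket j) (ket i) = 0"
    and I: "finite I" "I \<noteq> {}" and H: "\<And>k. k \<in> I \<Longrightarrow> closed_csubspace (H k)"
    and TO: "hilbert_tensor_family I H TO" and TSO: "hilbert_tensor TSO"
    and c: "ci \<noteq> 0" "cj \<noteq> 0"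
    and proportional: "\<And>w w'. ci * cinner (TSO (ket i) w) (\<sigma> (TSO (ket i) w')) =
      cj * cinner (TSO (ket j) w) (\<sigma> (TSO (ket j) w'))"
  shows False
proof -
  obtain p \<rho> \<rho>O C where p: "(\<Sum>l\<in>{i, j}. p l) = 1"
    and \<sigma>: "\<sigma> = (\<lambda>x. \<Sum>l\<in>{i, j}. p l *\<^sub>R C l x)"
    and \<rho>': "\<forall>l\<in>{i, j}. \<forall>k\<in>I. density_on (H k) (\<rho> l k)"
    and \<rho>O': "\<forall>l\<in>{i, j}. tensor_op_family I H TO (\<rho> l) (\<rho>O l)"
    and C': "\<forall>l\<in>{i, j}. tensor_op TSO (ketbra (ket l) (ket l)) (\<rho>O l) (C l)"
    and orth: "\<forall>k\<in>I. \<forall>l\<in>{i, j}. \<forall>m\<in>{i, j}. l \<noteq> m \<longrightarrow> (\<forall>x\<in>H k. \<rho> l k (\<rho> m k x) = 0)"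
    using sbs unfolding sbs_state_def by (elim exE conjE) (rule that)
  note \<rho> = \<rho>'[rule_format] and \<rho>O = \<rho>O'[rule_format] and C = C'[rule_format]
  note C_cinner = product_state_cinner[OF TSO C]
  have block: "cinner (TSO (ket l) w) (\<sigma> (TSO (ket l) w')) = p l * cinner w (\<rho>O l w')"
    if "l \<in> {i, j}" for l w w'
    using that \<open>i \<noteq> j\<close> unfolding \<sigma>
    by (auto simp: cinner_add_right cinner_scaleR_right C_cinner ketbra_def ket cinner_scaleC_right)
  have \<rho>O_prop: "(ci * p i) *\<^sub>C \<rho>O i w = (cj * p j) *\<^sub>C \<rho>O j w" for w
    by (rule cinner_eqI) (use proportional[of _ w] in \<open>simp add: block cinner_scaleC_right mult.assoc\<close>)
  \<comment> \<open>The probabilities sum to 1, so one is nonzero; the other may vanish, in which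
    case \<open>d'\<close> below is zero.\<close>
  have "\<exists>l m. {l, m} = {i, j} \<and> p l \<noteq> 0"
    using p \<open>i \<noteq> j\<close> by (cases "p i = 0") auto
  then obtain l m where lm: "{l, m} = {i, j}" and pl: "p l \<noteq> 0" by blast
  have l: "l \<in> {i, j}" and m: "m \<in> {i, j}" using lm by blast+
  have "l \<noteq> m" using lm \<open>i \<noteq> j\<close> by auto
  obtain d d' where d: "d \<noteq> 0" and \<rho>O_lm: "\<And>w. d *\<^sub>C \<rho>O l w = d' *\<^sub>C \<rho>O m w"
  proof (cases "l = i")
    case True
    with lm \<open>i \<noteq> j\<close> have "m = j" by auto
    then show ?thesis using that[of "ci * p i" "cj * p j"] True pl c \<rho>O_prop by auto
  next
    case False
    with lm have "l = j" "m = i" by auto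
    then show ?thesis using that[of "cj * p j" "ci * p i"] pl c \<rho>O_prop by auto
  qed
  have pos: "positive_op_on (H k) (\<rho> l' k)" if "l' \<in> {i, j}" "k \<in> I" for l' k
    using \<rho>[OF that] by (simp add: density_on_def)
  have mem: "\<rho> l' k y \<in> H k" if "l' \<in> {i, j}" "k \<in> I" "y \<in> H k" for l' k y
    using pos[OF that(1,2)] that(3) by (simp add: positive_op_on_def bounded_op_on_def)
  have "\<exists>x. x \<in> H k \<and> \<rho> l k (\<rho> l k x) \<noteq> 0" if "k \<in> I" for k
    using density_sq_nonzero[OF H[OF that] \<rho>[OF l that]] by blast
  then obtain x where x: "\<And>k. k \<in> I \<Longrightarrow> x k \<in> H k" "\<And>k. k \<in> I \<Longrightarrow> \<rho> l k (\<rho> l k (x k)) \<noteq> 0"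
    by metis
  have app: "\<rho>O l' (TO y) = TO (\<lambda>k. \<rho> l' k (y k))" if "l' \<in> {i, j}" "y \<in> Pi I H" for l' y
    using \<rho>O[OF that(1)] that(2) by (simp add: tensor_op_family_def)
  have app2: "norm (\<rho>O l (\<rho>O l' (TO x))) = (\<Prod>k\<in>I. norm (\<rho> l k (\<rho> l' k (x k))))" if "l' \<in> {i, j}" for l'
  proof -
    have "x \<in> Pi I H" "(\<lambda>k. \<rho> l' k (x k)) \<in> Pi I H" "(\<lambda>k. \<rho> l k (\<rho> l' k (x k))) \<in> Pi I H"
      using x mem that l by auto
    then show ?thesis using that l by (simp add: app tensor_family_norm[OF TO])
  qed
  \<comment> \<open>A single vanishing factor annihilates the product of norms, and \<open>I\<close>
    is nonempty.\<close>
  have "norm (\<rho>O l (\<rho>O m (TO x))) = 0"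
    unfolding app2[OF m] using I orth l m \<open>l \<noteq> m\<close> x(1) by (auto simp: prod_zero_iff)
  moreover have bo: "bounded_op_on UNIV (\<rho>O l)"
    using \<rho>O[OF l] by (simp add: tensor_op_family_def)
  ultimately have "d *\<^sub>C \<rho>O l (\<rho>O l (TO x)) = 0"
    using arg_cong[OF \<rho>O_lm, of "\<rho>O l" "TO x"] by (simp add: bounded_opD(2)[OF bo])
  then have "norm (\<rho>O l (\<rho>O l (TO x))) = 0"
    using d norm_scaleC[of d "\<rho>O l (\<rho>O l (TO x))"] by simp
  then show False
    unfolding app2[OF l] using x(2) I by simp
qed

text \<open>Tracing out a part of the environment leaves the system vectors fixed, so the block
  relation holds term by term in any basis of the traced space and passes to the sums.\<close>

lemma partial_trace_blocks_eq:
  fixes TRO :: "'r::chilbert_space \<Rightarrow> 'o::chilbert_space \<Rightarrow> 'e::chilbert_space"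
  assumes tr: "is_partial_trace TSE TRO TSO A B"
    and eq: "\<And>e e'. c * cinner (TSE s e) (A (TSE s e')) = d * cinner (TSE s' e) (A (TSE s' e'))"
  shows "c * cinner (TSO s w) (B (TSO s w')) = d * cinner (TSO s' w) (B (TSO s' w'))"
proof -
  obtain F :: "'r set" where F: "onb_on UNIV F"
    using onb_on_exists[of "UNIV :: 'r set"] by auto
  have sum: "((\<lambda>e. cinner (TSE z (TRO e w)) (A (TSE z (TRO e w')))) has_sum cinner (TSO z w) (B (TSO z w'))) F"
    for z using tr F unfolding is_partial_trace_def by blast
  from has_sum_cmult_right[OF sum[of s], of c] has_sum_cmult_right[OF sum[of s'], of d]
  show ?thesis unfolding eq by (rule has_sum_unique)
qed

text \<open>\<open>U\<close> is constrained by its generator alone, so the product form of the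
  evolution is derived and stated as the first conjunct.\<close>

theorem proposition1:
  fixes ket :: "nat \<Rightarrow> complex ^ 2"
    and N :: nat
    and H :: "nat \<Rightarrow> 'h::chilbert_space set"
    and TO :: "(nat \<Rightarrow> 'h) \<Rightarrow> 'o::chilbert_space"
    and TRO :: "'r::chilbert_space \<Rightarrow> 'o \<Rightarrow> 'e::chilbert_space"
    and TSE :: "complex ^ 2 \<Rightarrow> 'e \<Rightarrow> 't::chilbert_space"
    and TSO :: "complex ^ 2 \<Rightarrow> 'o \<Rightarrow> 'q::chilbert_space"
    and \<epsilon> :: "nat \<Rightarrow> real"
    and Vnot :: "nat \<Rightarrow> ('r \<times> 'r) set"
    and V :: "nat \<Rightarrow> nat \<Rightarrow> ('h \<times> 'h) set"
    and unot :: "nat \<Rightarrow> real \<Rightarrow> 'r \<Rightarrow> 'r"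
    and u :: "nat \<Rightarrow> nat \<Rightarrow> real \<Rightarrow> 'h \<Rightarrow> 'h"
    and U :: "real \<Rightarrow> 't \<Rightarrow> 't"
    and a :: "nat \<Rightarrow> complex"
    and \<psi>0 :: "complex ^ 2"
    and Rnot :: "'r \<Rightarrow> 'r"
    and \<rho> :: "nat \<Rightarrow> 'h \<Rightarrow> 'h"
    and \<rho>O :: "'o \<Rightarrow> 'o" and \<rho>E :: "'e \<Rightarrow> 'e"
    and \<sigma>0 :: "'t \<Rightarrow> 't"
    and \<sigma>tot :: "real \<Rightarrow> 't \<Rightarrow> 't"
    and \<sigma> :: "real \<Rightarrow> 'q \<Rightarrow> 'q"
  assumes pointer_basis: "inj_on ket {0, 1}" "onb_on UNIV (ket ` {0, 1})"
    and N: "N \<ge> 1"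
    and H: "\<And>k. k \<in> {1..N} \<Longrightarrow> closed_csubspace (H k)" "\<And>k. k \<in> {1..N} \<Longrightarrow> H k \<noteq> {0}"
    and Hnot: "(UNIV :: 'r set) \<noteq> {0}"
    and TO: "hilbert_tensor_family {1..N} H TO"
    and TRO: "hilbert_tensor TRO"
    and TSE: "hilbert_tensor TSE"
    and TSO: "hilbert_tensor TSO"
    and Vnot: "\<And>i. i \<in> {0, 1} \<Longrightarrow> self_adjoint_on UNIV (Vnot i)"
    and V: "\<And>i k. i \<in> {0, 1} \<Longrightarrow> k \<in> {1..N} \<Longrightarrow> self_adjoint_on (H k) (V i k)"
    and unot: "\<And>i. i \<in> {0, 1} \<Longrightarrow> evolution_on UNIV (Vnot i) (unot i)"
    and u: "\<And>i k. i \<in> {0, 1} \<Longrightarrow> k \<in> {1..N} \<Longrightarrow> evolution_on (H k) (V i k) (u i k)"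
    and U: "evolution_on UNIV
      (dephasing_hamiltonian {0, 1} ket {1..N} TO TRO TSE \<epsilon> Vnot V) U"
    and a: "(cmod (a 0))\<^sup>2 + (cmod (a 1))\<^sup>2 = 1" "a 0 \<noteq> 0" "a 1 \<noteq> 0"
    and \<psi>0: "\<psi>0 = a 0 *\<^sub>C ket 0 + a 1 *\<^sub>C ket 1"
    and Rnot: "density_on UNIV Rnot"
    and \<rho>: "\<And>k. k \<in> {1..N} \<Longrightarrow> density_on (H k) (\<rho> k)"
    and \<sigma>0: "tensor_op_family {1..N} H TO \<rho> \<rho>O" "tensor_op TRO Rnot \<rho>O \<rho>E"
      "tensor_op TSE (ketbra \<psi>0 \<psi>0) \<rho>E \<sigma>0"
    and \<sigma>tot: "\<And>t. \<sigma>tot t = U t \<circ> \<sigma>0 \<circ> cadjoint (U t)"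
    and \<sigma>: "\<And>t. is_partial_trace TSE TRO TSO (\<sigma>tot t) (\<sigma> t)"
  shows "(\<forall>t s r. \<forall>x\<in>Pi {1..N} H.
            U t (TSE s (TRO r (TO x))) =
            (\<Sum>i\<in>{0, 1}. exp (- \<i> * \<epsilon> i * t) *\<^sub>C
               TSE (ketbra (ket i) (ket i) s)
                   (TRO (unot i t r) (TO (\<lambda>k. u i k t (x k)))))) \<and>
         (\<forall>t. separable_state TSE (\<sigma>tot t) \<longrightarrow>
            \<not> sbs_state {0, 1} ket {1..N} H TO TSO (\<sigma> t))"
proof -
  note ket = onb_pair_expansion[OF pointer_basis zero_neq_one]
  have UG: "unitary_group_on UNIV U"
    using U by (simp add: evolution_on_def)
  have prod: "U t (TSE (ket i) (TRO r (TO x))) =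
      exp (- \<i> * \<epsilon> i * t) *\<^sub>C TSE (ket i) (TRO (unot i t r) (TO (\<lambda>k. u i k t (x k))))"
    if "i \<in> {0, 1}" "x \<in> Pi {1..N} H" for i t r x
    by (rule dephasing_evolution_product[OF TO finite_atLeastAtMost H(1) TRO TSE Vnot[OF that(1)]
          V[OF that(1)] unot[OF that(1)] u[OF that(1)] U that])
  have "U t (TSE s (TRO r (TO x))) =
      (\<Sum>i\<in>{0, 1}. exp (- \<i> * \<epsilon> i * t) *\<^sub>C
        TSE (ketbra (ket i) (ket i) s) (TRO (unot i t r) (TO (\<lambda>k. u i k t (x k)))))"
    if x: "x \<in> Pi {1..N} H" for t s r x
  proof -
    \<comment> \<open>Expanding \<open>s\<close> in the pointer basis reduces the formula to the two
      blocks.\<close>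
    have "TSE s (TRO r (TO x)) = cinner (ket 0) s *\<^sub>C TSE (ket 0) (TRO r (TO x)) +
        cinner (ket 1) s *\<^sub>C TSE (ket 1) (TRO r (TO x))"
      by (subst ket(5)[of s]) (simp only: hilbert_tensorD(1,3)[OF TSE])
    then show ?thesis
      by (simp add: unitary_group_linear[OF _ UG] prod[OF _ x] ketbra_def hilbert_tensorD(3)[OF TSE]
          scaleC_scaleC mult.commute)
  qed
  moreover have "\<not> sbs_state {0, 1} ket {1..N} H TO TSO (\<sigma> t)"
    if sep: "separable_state TSE (\<sigma>tot t)" for t
  proof
    assume sbs: "sbs_state {0, 1} ket {1..N} H TO TSO (\<sigma> t)"
    have norm_ket: "norm (ket i) = 1" if "i \<in> {0, 1}" for i
    proof -
      have "cinner (ket i) (ket i) = 1" using that ket by auto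
      then have "(norm (ket i))\<^sup>2 = 1\<^sup>2"
        by (simp add: cinner_self flip: of_real_power)
      then show ?thesis by (rule power2_eq_imp_eq) auto
    qed
    have block: "U t' (TSE (ket i) e) \<in> range (TSE (ket i))" if i: "i \<in> {0, 1}" for i t' e
    proof (rule evolution_preserves_block[OF TO TRO TSE UG norm_ket[OF i]])
      show "U t' (TSE (ket i) (TRO r (TO x))) \<in> range (TSE (ket i))" if "x \<in> Pi {1..N} H" for r x
        unfolding prod[OF i that] hilbert_tensorD(4)[OF TSE, symmetric] by (rule rangeI)
    qed
    have "bounded_op_on UNIV \<rho>E"
      using \<sigma>0(2) by (simp add: tensor_op_def)
    note eq = separable_dephasing_blocks_eq[where a = a, OF TSE UG ket(1-4) block \<psi>0 a(2,3) \<sigma>0(3) this \<sigma>tot sep]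
    note traced = partial_trace_blocks_eq[OF \<sigma> eq]
    show False
      by (rule sbs_state_not_proportional[OF sbs zero_neq_one ket(1-4) _ _ H(1) TO TSO _ _ traced])
        (use N a in auto)
  qed
  ultimately show ?thesis by blast
qed

end
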